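(* The relations $\leq^{\mathrm{mv}}_{\mathrm{raw},\mathrm{fq}}$ and $\leq^{\mathrm{mv}}_{\mathrm{TTE},\mathrm{fq}}$ on multivalued typed SCI problems are preorders, and for such problems $S,P$: $$S\leq^{\mathrm{mv}}_{\mathrm{raw},\mathrm{fq}}P\ \Longrightarrow\ \operatorname{SCI}^{\mathrm{mv}}_{\mathrm G}(S)\leq\operatorname{SCI}^{\mathrm{mv}}_{\mathrm G}(P),$$ $$S\leq^{\mathrm{mv}}_{\mathrm{TTE},\mathrm{fq}}P\ \Longrightarrow\ \widehat F_S\leq_{\mathrm{sW}}\widehat F_P\ \Longrightarrow\ \widehat F_S\leq_{\mathrm W}\widehat F_P.$$ Accordingly $S\leq^{\mathrm{mv}}_{\mathrm{TTE},\mathrm{fq}}P$ also implies $\operatorname{rk}_{\lim}(\widehat F_S)\leq\operatorname{rk}_{\lim}(\widehat F_P)$ and $\operatorname{SCI}^{\lim,\mathrm{mv}}_{\mathrm{Comp}}(S)\leq\operatorname{SCI}^{\lim,\mathrm{mv}}_{\mathrm{Comp}}(P)$.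
   Context: Type-2 conventions. $\mathbb N=\{0,1,2,\dots\}$; a computable bijective pairing $\langle\cdot,\cdot\rangle:\mathbb N^2\to\mathbb N$ is fixed. Computability on Baire space $\mathbb N^{\mathbb N}$ is Type-2 computability. A representation of $X$ is a partial surjection $\delta_X:\subseteq\mathbb N^{\mathbb N}\to X$. A realizer of a represented problem $g:\subseteq U\rightrightarrows V$ sends each name of each $u\in\operatorname{dom}(g)$ to a name of an element of $g(u)$. $f\leq_{\mathrm W}g$ (resp. $f\leq_{\mathrm{sW}}g$): there are computable partial functionals $K,H$ such that for every realizer $G$ of $g$, $p\mapsto H(p,G(K(p)))$ (resp. $p\mapsto H(G(K(p)))$) realizes $f$. $\operatorname{Lim}(P)(j)=\lim_sP(\langle s,j\rangle)$, with domain those $P$ all of whose columns $s\mapsto P(\langle s,j\rangle)$ are eventually constant; $\operatorname{Lim}^{(0)}=\mathrm{id}$, $\operatorname{Lim}^{(k+1)}=\operatorname{Lim}\circ\operatorname{Lim}^{(k)}$; $\operatorname{rk}_{\lim}(f)=\min\{k:f\leq_{\mathrm W}\operatorname{Lim}^{(k)}\}$ ($\infty$ if none). Multivalued typed SCI problems. $P=(F_P,\Omega_P,(M_P,d_P),\Lambda_P)$, where $F_P:\Omega_P\rightrightarrows M_P$ has nonempty values in a metric space, and $\Lambda_P$ is a nonempty, countable, effectively indexed family of evaluations $\lambda:\Omega_P\to V_\lambda$ with specified value spaces. Consistency: if $\lambda(x)=\lambda(y)$ for all $\lambda\in\Lambda_P$ then $F_P(x)=F_P(y)$. A general algorithm is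 a pair $(\Gamma,Q_\Gamma)$ with single-valued $\Gamma:\Omega_P\to M_P$ and finite nonempty $Q_\Gamma(x)\subseteq\Lambda_P$ for each $x$, such that if $y$ agrees with $x$ on all evaluations in $Q_\Gamma(x)$, then $\Gamma(y)=\Gamma(x)$ and $Q_\Gamma(y)=Q_\Gamma(x)$ (no computability or continuity is required). A height-$k$ raw tower ($k\geq1$) is a family of general algorithms $\Gamma_{n_k,\dots,n_1}$ such that all successive pointwise limits $\lim_{n_k}\cdots\lim_{n_1}\Gamma_{n_k,\dots,n_1}(x)$ exist in $M_P$ and the final value lies in $F_P(x)$, for every $x$ (intermediate limit maps need not be general algorithms). Height $0$: a general algorithm $\Gamma$ with $\Gamma(x)\in F_P(x)$ for all $x$. $\operatorname{SCI}^{\mathrm{mv}}_{\mathrm G}(P)$ is the least height ($\infty$ if none). Represented version (used for TTE and Weihrauch statements). Evaluation-value spaces and $M_P$ carry fixed representations; the table map $\operatorname{Ev}_P(x)=(\lambda(x))_{\lambda\in\Lambda_P}$ is required to be injective; its image $I_{\Lambda_P}$ has the subspace product representation, and $\Omega_P$ has the representation transported back along $\operatorname{Ev}_P$. The factor relation is $\widehat F_P(\operatorname{Ev}_P(x))=F_P(x)$, a represented problem $I_{\Lambda_P}\rightrightarrows M_P$. $\operatorname{SCI}^{\lim,\mathrm{mv}}_{\mathrm{Comp}}(P)$ is the least $k$ for which there is a computable partial functional $K$ such that for every name $p$ of every input of $\widehat F_P$, $\operatorname{Lim}^{(k)}(K(p))$ is defined and names an element of the corresponding solution set ($\infty$ if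 none). Transports. $S\leq^{\mathrm{mv}}_{\mathrm{raw},\mathrm{fq}}P$ if there are a map $E:\Omega_S\to\Omega_P$, a total continuous map of metric spaces $D:M_P\to M_S$, and, for each indexed evaluation $\lambda_e$ of $\Lambda_P$, a finite list (depending on $e$ only, possibly empty) of evaluations $\gamma_{i(e,1)},\dots,\gamma_{i(e,m_e)}$ of $\Lambda_S$ and a map $\vartheta_e$ on their transcript image $\{(\gamma_{i(e,1)}(x),\dots,\gamma_{i(e,m_e)}(x)):x\in\Omega_S\}$ such that for all $x\in\Omega_S$ $$\varnothing\neq D[F_P(E(x))]\subseteq F_S(x),\qquad \lambda_e(E(x))=\vartheta_e\bigl(\gamma_{i(e,1)}(x),\dots,\gamma_{i(e,m_e)}(x)\bigr).$$ $S\leq^{\mathrm{mv}}_{\mathrm{TTE},\mathrm{fq}}P$ if in addition (with the evaluation-induced instance representations) $E,D$ have computable realizers and a single computable procedure, given $e$, produces the finite index list and an index of a partial computable reconstruction $\widehat\vartheta_e$ whose domain contains the whole transcript image and which satisfies the second displayed identity. *)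

theory Defs
  imports "HOL-Analysis.Analysis" "HOL-Library.Nat_Bijection"
begin

section \<open>Type-2 computability\<close>

type_synonym baire = "nat \<Rightarrow> nat"

abbreviation pr :: "nat \<Rightarrow> nat \<Rightarrow> nat" where
  "pr a b \<equiv> prod_encode (a, b)"

text \<open>
  Oracle programs are Kleene's \<open>\<mu>\<close>-recursive schemes relative to an oracle \<open>p\<close>, written for unary
  functions; several arguments are passed through the pairing. The semantics is partial:
  \<open>run p c x = None\<close> means that program \<open>c\<close> with oracle \<open>p\<close> diverges on input \<open>x\<close>.
\<close>

datatype prog =
    ZeroP | SuccP | FstP | SndP | QueryP
  | PairP prog prog | CompP prog prog | RecP prog prog | MuP prog

primrec run :: "baire \<Rightarrow> prog \<Rightarrow> nat \<Rightarrow> nat option" where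
  "run p ZeroP x = Some 0"
| "run p SuccP x = Some (Suc x)"
| "run p FstP x = Some (fst (prod_decode x))"
| "run p SndP x = Some (snd (prod_decode x))"
| "run p QueryP x = Some (p x)"
| "run p (PairP a b) x =
     Option.bind (run p a x) (\<lambda>y. Option.bind (run p b x) (\<lambda>z. Some (pr y z)))"
| "run p (CompP a b) x = Option.bind (run p b x) (run p a)"
| "run p (RecP a b) x =
     (case prod_decode x of (u, n) \<Rightarrow>
        rec_nat (run p a u) (\<lambda>m r. Option.bind r (\<lambda>y. run p b (pr u (pr m y)))) n)"
| "run p (MuP a) x =
     (if \<exists>n. run p a (pr x n) = Some 0 \<and> (\<forall>m<n. run p a (pr x m) \<noteq> None)
      then Some (LEAST n. run p a (pr x n) = Some 0) else None)"

text \<open>Goedel numbering: the index of a program.\<close>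

primrec index_of :: "prog \<Rightarrow> nat" where
  "index_of ZeroP = pr 0 0"
| "index_of SuccP = pr 1 0"
| "index_of FstP = pr 2 0"
| "index_of SndP = pr 3 0"
| "index_of QueryP = pr 4 0"
| "index_of (PairP a b) = pr 5 (pr (index_of a) (index_of b))"
| "index_of (CompP a b) = pr 6 (pr (index_of a) (index_of b))"
| "index_of (RecP a b) = pr 7 (pr (index_of a) (index_of b))"
| "index_of (MuP a) = pr 8 (index_of a)"

lemma inj_index_of: "inj index_of"
proof
  fix a b assume "index_of a = index_of b"
  then show "a = b"
    by (induction a arbitrary: b) (case_tac b; simp add: prod_encode_eq)+
qed

text \<open>Computation on numbers is oracle computation with the zero oracle.\<close>

definition decidable :: "nat set \<Rightarrow> bool" where
  "decidable A \<longleftrightarrow> (\<exists>c. \<forall>n. run (\<lambda>_. 0) c n = Some (if n \<in> A then 1 else 0))"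

text \<open>The partial functional on Baire space computed by an oracle program; \<open>p\<close> is in the domain
  iff the program halts on all inputs.\<close>

definition functional :: "prog \<Rightarrow> baire \<Rightarrow> baire option" where
  "functional c p = (if \<forall>n. run p c n \<noteq> None then Some (\<lambda>n. the (run p c n)) else None)"

text \<open>As usual, a computable partial functional is a restriction of one computed by a program.\<close>

definition computable_functional :: "(baire \<Rightarrow> baire option) \<Rightarrow> bool" where
  "computable_functional K \<longleftrightarrow> (\<exists>c. K \<subseteq>\<^sub>m functional c)"

definition col :: "baire \<Rightarrow> nat \<Rightarrow> baire" where
  "col p i = (\<lambda>n. p (pr i n))"

text \<open>Pairing on Baire space: column 0 holds \<open>p\<close>, all other columns hold \<open>q\<close>.\<close>

definition bpair :: "baire \<Rightarrow> baire \<Rightarrow> baire" where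
  "bpair p q = (\<lambda>m. case prod_decode m of (i, n) \<Rightarrow> if i = 0 then p n else q n)"

section \<open>Representations, represented problems, Weihrauch reducibility\<close>

type_synonym 'a rep = "baire \<Rightarrow> 'a option"

definition representation :: "'a rep \<Rightarrow> 'a set \<Rightarrow> bool" where
  "representation \<delta> X \<longleftrightarrow> ran \<delta> = X"

definition computable_map :: "'a rep \<Rightarrow> 'b rep \<Rightarrow> ('a \<Rightarrow> 'b) \<Rightarrow> bool" where
  "computable_map \<delta> \<epsilon> f \<longleftrightarrow>
     (\<exists>K. computable_functional K \<and>
        (\<forall>p x. \<delta> p = Some x \<longrightarrow> (\<exists>q. K p = Some q \<and> \<epsilon> q = Some (f x))))"

text \<open>Representation of a countable product: column \<open>e\<close> names the component with index \<open>e\<close>; columns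
  outside the index set are ignored.\<close>

definition prod_rep :: "nat set \<Rightarrow> (nat \<Rightarrow> 'a rep) \<Rightarrow> (nat \<Rightarrow> 'a) rep" where
  "prod_rep I \<delta> p =
     (if \<forall>e\<in>I. \<delta> e (col p e) \<noteq> None then Some (\<lambda>e\<in>I. the (\<delta> e (col p e))) else None)"

definition list_rep :: "'a rep list \<Rightarrow> 'a list rep" where
  "list_rep \<delta>s p =
     (if \<forall>j<length \<delta>s. (\<delta>s ! j) (col p j) \<noteq> None
      then Some (map (\<lambda>j. the ((\<delta>s ! j) (col p j))) [0..<length \<delta>s]) else None)"

definition subspace_rep :: "'a set \<Rightarrow> 'a rep \<Rightarrow> 'a rep" where
  "subspace_rep A \<delta> p = Option.bind (\<delta> p) (\<lambda>x. if x \<in> A then Some x else None)"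

text \<open>A represented problem; its domain consists of the \<open>u\<close> with \<open>sol g u \<noteq> {}\<close>.\<close>

record ('u, 'v) rproblem =
  in_rep :: "'u rep"
  out_rep :: "'v rep"
  sol :: "'u \<Rightarrow> 'v set"

definition realizer :: "('u, 'v) rproblem \<Rightarrow> (baire \<Rightarrow> baire option) \<Rightarrow> bool" where
  "realizer g G \<longleftrightarrow>
     (\<forall>p u. in_rep g p = Some u \<and> sol g u \<noteq> {} \<longrightarrow>
        (\<exists>q v. G p = Some q \<and> out_rep g q = Some v \<and> v \<in> sol g u))"

definition W_le :: "('u, 'v) rproblem \<Rightarrow> ('s, 't) rproblem \<Rightarrow> bool" where
  "W_le f g \<longleftrightarrow>
     (\<exists>K H. computable_functional K \<and> computable_functional H \<and>
        (\<forall>G. realizer g G \<longrightarrow>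
           realizer f (\<lambda>p. Option.bind (Option.bind (K p) G) (\<lambda>q. H (bpair p q)))))"

definition sW_le :: "('u, 'v) rproblem \<Rightarrow> ('s, 't) rproblem \<Rightarrow> bool" where
  "sW_le f g \<longleftrightarrow>
     (\<exists>K H. computable_functional K \<and> computable_functional H \<and>
        (\<forall>G. realizer g G \<longrightarrow> realizer f (\<lambda>p. Option.bind (Option.bind (K p) G) H)))"

definition Lim :: "baire \<Rightarrow> baire option" where
  "Lim P =
     (if \<forall>j. \<exists>v. \<forall>\<^sub>F s in sequentially. P (pr s j) = v
      then Some (\<lambda>j. THE v. \<forall>\<^sub>F s in sequentially. P (pr s j) = v) else None)"

primrec Lim_pow :: "nat \<Rightarrow> baire \<Rightarrow> baire option" where
  "Lim_pow 0 P = Some P"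
| "Lim_pow (Suc k) P = Option.bind (Lim_pow k P) Lim"

definition Lim_problem :: "nat \<Rightarrow> (baire, baire) rproblem" where
  "Lim_problem k = \<lparr> in_rep = Some, out_rep = Some, sol = (\<lambda>P. set_option (Lim_pow k P)) \<rparr>"

definition rk_lim :: "('u, 'v) rproblem \<Rightarrow> enat" where
  "rk_lim f = Inf {enat k | k. W_le f (Lim_problem k)}"

section \<open>Multivalued typed SCI problems\<close>

text \<open>
  The carriers of the instance space and of the value spaces are sets; the metric space is an
  element of the library type of metric spaces with explicit carrier. The evaluations are
  \<open>eval_at P e\<close> for \<open>e\<close> in the index set \<open>idx P\<close>; the value space of evaluation \<open>e\<close> is \<open>vals P e\<close>.
\<close>

record ('x, 'v, 'm) sci =
  inst :: "'x set"
  met :: "'m metric"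
  target :: "'x \<Rightarrow> 'm set"
  idx :: "nat set"
  vals :: "nat \<Rightarrow> 'v set"
  eval_at :: "nat \<Rightarrow> 'x \<Rightarrow> 'v"

definition sci_problem :: "('x, 'v, 'm, 'z) sci_scheme \<Rightarrow> bool" where
  "sci_problem P \<longleftrightarrow>
     (\<forall>x\<in>inst P. target P x \<noteq> {} \<and> target P x \<subseteq> mspace (met P)) \<and>
     idx P \<noteq> {} \<and> decidable (idx P) \<and>
     (\<forall>e\<in>idx P. eval_at P e \<in> inst P \<rightarrow> vals P e) \<and>
     (\<forall>x\<in>inst P. \<forall>y\<in>inst P. (\<forall>e\<in>idx P. eval_at P e x = eval_at P e y) \<longrightarrow> target P x = target P y)"

definition general_algorithm ::
  "('x, 'v, 'm, 'z) sci_scheme \<Rightarrow> ('x \<Rightarrow> 'm) \<Rightarrow> ('x \<Rightarrow> nat set) \<Rightarrow> bool" where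
  "general_algorithm P \<Gamma> Q \<longleftrightarrow>
     \<Gamma> \<in> inst P \<rightarrow> mspace (met P) \<and>
     (\<forall>x\<in>inst P. finite (Q x) \<and> Q x \<noteq> {} \<and> Q x \<subseteq> idx P) \<and>
     (\<forall>x\<in>inst P. \<forall>y\<in>inst P. (\<forall>e\<in>Q x. eval_at P e y = eval_at P e x) \<longrightarrow> \<Gamma> y = \<Gamma> x \<and> Q y = Q x)"

text \<open>\<open>iterated_limit T k g l\<close>: all successive limits of \<open>g [n\<^sub>k, \<dots>, n\<^sub>1]\<close> exist, innermost \<open>n\<^sub>1\<close> first,
  and the final value is \<open>l\<close>.\<close>

primrec iterated_limit :: "'m topology \<Rightarrow> nat \<Rightarrow> (nat list \<Rightarrow> 'm) \<Rightarrow> 'm \<Rightarrow> bool" where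
  "iterated_limit T 0 g l \<longleftrightarrow> g [] = l"
| "iterated_limit T (Suc k) g l \<longleftrightarrow>
     (\<exists>h. (\<forall>n. iterated_limit T k (\<lambda>ns. g (n # ns)) (h n)) \<and> limitin T h l sequentially)"

text \<open>For \<open>k = 0\<close> this is a single general algorithm with \<open>\<Gamma> [] x \<in> target P x\<close>.\<close>

definition raw_tower ::
  "('x, 'v, 'm, 'z) sci_scheme \<Rightarrow> nat \<Rightarrow> (nat list \<Rightarrow> 'x \<Rightarrow> 'm) \<Rightarrow> (nat list \<Rightarrow> 'x \<Rightarrow> nat set) \<Rightarrow> bool"
  where
  "raw_tower P k \<Gamma> Q \<longleftrightarrow>
     (\<forall>ns. length ns = k \<longrightarrow> general_algorithm P (\<Gamma> ns) (Q ns)) \<and>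
     (\<forall>x\<in>inst P. \<exists>l\<in>target P x. iterated_limit (mtopology_of (met P)) k (\<lambda>ns. \<Gamma> ns x) l)"

definition SCI_G :: "('x, 'v, 'm, 'z) sci_scheme \<Rightarrow> enat" where
  "SCI_G P = Inf {enat k | k. \<exists>\<Gamma> Q. raw_tower P k \<Gamma> Q}"

section \<open>Represented SCI problems\<close>

record ('x, 'v, 'm) rsci = "('x, 'v, 'm) sci" +
  val_rep :: "nat \<Rightarrow> 'v rep"
  met_rep :: "'m rep"

definition table :: "('x, 'v, 'm, 'z) sci_scheme \<Rightarrow> 'x \<Rightarrow> nat \<Rightarrow> 'v" where
  "table P x = (\<lambda>e\<in>idx P. eval_at P e x)"

definition represented_sci :: "('x, 'v, 'm) rsci \<Rightarrow> bool" where
  "represented_sci P \<longleftrightarrow>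
     sci_problem P \<and>
     (\<forall>e\<in>idx P. representation (val_rep P e) (vals P e)) \<and>
     representation (met_rep P) (mspace (met P)) \<and>
     inj_on (table P) (inst P)"

definition table_rep :: "('x, 'v, 'm) rsci \<Rightarrow> (nat \<Rightarrow> 'v) rep" where
  "table_rep P = subspace_rep (table P ` inst P) (prod_rep (idx P) (val_rep P))"

text \<open>The evaluation-induced representation of the instance space.\<close>

definition inst_rep :: "('x, 'v, 'm) rsci \<Rightarrow> 'x rep" where
  "inst_rep P p = map_option (inv_into (inst P) (table P)) (table_rep P p)"

text \<open>The factor relation: by injectivity the union below ranges over exactly one \<open>x\<close> if \<open>t\<close> is in
  the image of the table map, and over no \<open>x\<close> otherwise.\<close>

definition factor :: "('x, 'v, 'm) rsci \<Rightarrow> (nat \<Rightarrow> 'v, 'm) rproblem" where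
  "factor P =
     \<lparr> in_rep = table_rep P, out_rep = met_rep P,
       sol = (\<lambda>t. \<Union>x\<in>{x \<in> inst P. table P x = t}. target P x) \<rparr>"

definition SCI_Comp :: "('x, 'v, 'm) rsci \<Rightarrow> enat" where
  "SCI_Comp P = Inf {enat k | k. \<exists>K. computable_functional K \<and>
     (\<forall>p t. table_rep P p = Some t \<longrightarrow>
        (\<exists>q v. Option.bind (K p) (Lim_pow k) = Some q \<and> met_rep P q = Some v \<and> v \<in> sol (factor P) t))}"

section \<open>Transports\<close>

definition transcript :: "('x, 'v, 'm, 'z) sci_scheme \<Rightarrow> nat list \<Rightarrow> 'x \<Rightarrow> 'v list" where
  "transcript S is x = map (\<lambda>i. eval_at S i x) is"

text \<open>\<open>L e\<close> is the list of indices of the source evaluations queried for the target evaluation \<open>e\<close>;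
  only the values of \<open>\<theta> e\<close> on the transcript image matter.\<close>

definition raw_transport ::
  "('x, 'v, 'm, 'z) sci_scheme \<Rightarrow> ('y, 'w, 'n, 'z2) sci_scheme \<Rightarrow>
   ('x \<Rightarrow> 'y) \<Rightarrow> ('n \<Rightarrow> 'm) \<Rightarrow> (nat \<Rightarrow> nat list) \<Rightarrow> (nat \<Rightarrow> 'v list \<Rightarrow> 'w) \<Rightarrow> bool" where
  "raw_transport S P E D L \<theta> \<longleftrightarrow>
     E \<in> inst S \<rightarrow> inst P \<and>
     continuous_map (mtopology_of (met P)) (mtopology_of (met S)) D \<and>
     (\<forall>e\<in>idx P. set (L e) \<subseteq> idx S) \<and>
     (\<forall>x\<in>inst S. D ` target P (E x) \<noteq> {} \<and> D ` target P (E x) \<subseteq> target S x \<and>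
        (\<forall>e\<in>idx P. eval_at P e (E x) = \<theta> e (transcript S (L e) x)))"

definition raw_le :: "('x, 'v, 'm, 'z) sci_scheme \<Rightarrow> ('y, 'w, 'n, 'z2) sci_scheme \<Rightarrow> bool" where
  "raw_le S P \<longleftrightarrow> (\<exists>E D L \<theta>. raw_transport S P E D L \<theta>)"

text \<open>\<open>realizes_partial c \<delta> \<epsilon> f\<close>: the functional computed by \<open>c\<close> realizes the partial map \<open>f\<close>.\<close>

definition realizes_partial :: "prog \<Rightarrow> 'a rep \<Rightarrow> 'b rep \<Rightarrow> ('a \<Rightarrow> 'b option) \<Rightarrow> bool" where
  "realizes_partial c \<delta> \<epsilon> f \<longleftrightarrow>
     (\<forall>p a b. \<delta> p = Some a \<and> f a = Some b \<longrightarrow> (\<exists>q. functional c p = Some q \<and> \<epsilon> q = Some b))"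

text \<open>In \<open>tte_le\<close>, the program \<open>r\<close> computes from \<open>e\<close> the list \<open>L e\<close> and the index of a program \<open>c e\<close>
  realizing the partial reconstruction \<open>\<theta>h e\<close>.\<close>

definition tte_le :: "('x, 'v, 'm) rsci \<Rightarrow> ('y, 'w, 'n) rsci \<Rightarrow> bool" where
  "tte_le S P \<longleftrightarrow>
     (\<exists>E D L \<theta>. raw_transport S P E D L \<theta> \<and>
        computable_map (inst_rep S) (inst_rep P) E \<and>
        computable_map (met_rep P) (met_rep S) D \<and>
        (\<exists>r c \<theta>h. \<forall>e\<in>idx P.
           run (\<lambda>_. 0) r e = Some (pr (list_encode (L e)) (index_of (c e))) \<and>
           realizes_partial (c e) (list_rep (map (val_rep S) (L e))) (val_rep P e) (\<theta>h e) \<and>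
           (\<forall>x\<in>inst S. \<theta>h e (transcript S (L e) x) = Some (eval_at P e (E x)))))"

end

theory Submission
  imports Defs
begin

text \<open>
  A transport from \<open>S\<close> to \<open>P\<close> answers every evaluation of the instance \<open>E x\<close> by finitely many
  evaluations of \<open>x\<close> and pulls solutions back along \<open>D\<close>. An algorithm for \<open>P\<close> therefore becomes one
  for \<open>S\<close>: run it on \<open>E x\<close>, replace each queried evaluation by its query list, and apply \<open>D\<close>. As \<open>D\<close>
  is continuous, it commutes with all successive limits, so the height of a tower is preserved
  (\<open>raw_tower_transport\<close>). Transports compose by concatenating query lists
  (\<open>raw_transport_trans\<close>).

  In the effective setting, realizers of \<open>E\<close> and \<open>D\<close> are the two halves of a strong Weihrauch reduction
  between the factor relations (\<open>tte_le_imp_sW_le\<close>). Strong reductions are ordinary ones, and they can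
  be prefixed to a reduction to \<open>Lim_problem k\<close>, which gives the claim on \<open>rk_lim\<close>. For \<open>SCI_Comp\<close> the
  postprocessing by \<open>D\<close> has to move below the \<open>k\<close> limits: if \<open>H\<close> is computable, then
  \<open>H (Lim P) = Lim (J P)\<close> for a computable \<open>J\<close>, because a halting computation with oracle \<open>Lim P\<close> consults
  finitely many values, which \<open>col P s\<close> has already reached for all large \<open>s\<close>
  (\<open>Lim_absorbs_computable\<close>, iterated in \<open>Lim_pow_absorbs_computable\<close>).

  The laborious point is transitivity of \<open>tte_le\<close>. Here one program has to output, for each \<open>e\<close>, the
  concatenated query list together with the index of a program for the composed reconstruction. That
  composite results from substituting the inner reconstructions for the oracle queries of the outer one
  (\<open>list_rep_transcript_prog\<close>), and substitution acts recursively on indices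
  (\<open>recursive_subst_code\<close>, \<open>recursive_transcript_prog\<close>); it replaces an s-m-n theorem and a universal
  program.
\<close>

section \<open>Substitution of oracles\<close>

text \<open>
  Computable functionals compose because a program that computes the inner oracle can be written in
  place of each oracle query; no machine model has to be simulated.
\<close>

primrec subst :: "prog \<Rightarrow> prog \<Rightarrow> prog" where
  "subst d ZeroP = ZeroP"
| "subst d SuccP = SuccP"
| "subst d FstP = FstP"
| "subst d SndP = SndP"
| "subst d QueryP = d"
| "subst d (PairP a b) = PairP (subst d a) (subst d b)"
| "subst d (CompP a b) = CompP (subst d a) (subst d b)"
| "subst d (RecP a b) = RecP (subst d a) (subst d b)"
| "subst d (MuP a) = MuP (subst d a)"

lemma run_subst: "(\<And>n. run p d n = Some (q n)) \<Longrightarrow> run p (subst d c) x = run q c x"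
  by (induction c arbitrary: x) (simp_all cong: bind_option_cong)

lemma functional_eq_Some: "functional c p = Some q \<longleftrightarrow> (\<forall>n. run p c n = Some (q n))"
proof
  assume "functional c p = Some q"
  then show "\<forall>n. run p c n = Some (q n)"
    by (auto simp: functional_def split: if_splits)
next
  assume "\<forall>n. run p c n = Some (q n)"
  then show "functional c p = Some q"
    by (simp add: functional_def)
qed

lemma functional_subst: "functional d p = Some q \<Longrightarrow> functional (subst d c) p = functional c q"
  unfolding functional_eq_Some by (simp add: functional_def run_subst)

lemma computable_functionalD:
  assumes "computable_functional K"
  shows "\<exists>c. \<forall>p q. K p = Some q \<longrightarrow> functional c p = Some q"
proof -
  obtain c where "K \<subseteq>\<^sub>m functional c"
    using assms unfolding computable_functional_def by blast
  then have "\<forall>p q. K p = Some q \<longrightarrow> functional c p = Some q"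
    by (auto simp: map_le_def dom_def)
  then show ?thesis by blast
qed

lemma computable_functionalI:
  assumes "\<And>p q. K p = Some q \<Longrightarrow> functional c p = Some q"
  shows "computable_functional K"
proof -
  have "K \<subseteq>\<^sub>m functional c"
    unfolding map_le_def using assms by (auto simp: dom_def)
  then show ?thesis unfolding computable_functional_def by blast
qed

lemma computable_functional_bind:
  assumes "computable_functional K" "computable_functional H"
  shows "computable_functional (\<lambda>p. Option.bind (K p) H)"
proof -
  obtain c where c: "\<And>p q. K p = Some q \<Longrightarrow> functional c p = Some q"
    using computable_functionalD[OF assms(1)] by blast
  obtain d where d: "\<And>p q. H p = Some q \<Longrightarrow> functional d p = Some q"
    using computable_functionalD[OF assms(2)] by blast
  show ?thesis
  proof (rule computable_functionalI)
    fix p q assume "Option.bind (K p) H = Some q"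
    then show "functional (subst c d) p = Some q"
      by (auto simp: bind_eq_Some_conv dest!: c d simp: functional_subst)
  qed
qed

section \<open>Uniformly recursive functions\<close>

abbreviation pfst :: "nat \<Rightarrow> nat" where "pfst n \<equiv> fst (prod_decode n)"
abbreviation psnd :: "nat \<Rightarrow> nat" where "psnd n \<equiv> snd (prod_decode n)"

text \<open>
  The total functions computed by one program uniformly in the oracle. Functions on numbers occur
  as oracle-independent \<open>F\<close>, so that a single set of closure rules serves both for manipulating
  indices and for defining functionals on Baire space.
\<close>

definition recursive :: "(baire \<Rightarrow> nat \<Rightarrow> nat) \<Rightarrow> bool" where
  "recursive F \<longleftrightarrow> (\<exists>c. \<forall>p x. run p c x = Some (F p x))"

lemma recursiveI: "(\<And>p x. run p c x = Some (F p x)) \<Longrightarrow> recursive F"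
  unfolding recursive_def by (rule exI[of _ c]) simp

lemma recursive_comp:
  assumes "recursive F" "recursive G" shows "recursive (\<lambda>p x. F p (G p x))"
proof -
  obtain a b where "\<And>p x. run p a x = Some (F p x)" "\<And>p x. run p b x = Some (G p x)"
    using assms unfolding recursive_def by blast
  then show ?thesis by (intro recursiveI[of "CompP a b"]) simp
qed

lemma recursive_zero: "recursive (\<lambda>p x. 0)"
  by (rule recursiveI[of ZeroP]) simp

lemma recursive_id: "recursive (\<lambda>p x. x)"
  by (rule recursiveI[of "PairP FstP SndP"]) simp

lemma recursive_Suc: "recursive G \<Longrightarrow> recursive (\<lambda>p x. Suc (G p x))"
  by (rule recursive_comp[of "\<lambda>p. Suc", OF recursiveI[of SuccP]]) simp_all

lemma recursive_pfst: "recursive G \<Longrightarrow> recursive (\<lambda>p x. pfst (G p x))"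
  by (rule recursive_comp[of "\<lambda>p. pfst", OF recursiveI[of FstP]]) simp_all

lemma recursive_psnd: "recursive G \<Longrightarrow> recursive (\<lambda>p x. psnd (G p x))"
  by (rule recursive_comp[of "\<lambda>p. psnd", OF recursiveI[of SndP]]) simp_all

lemma recursive_query: "recursive G \<Longrightarrow> recursive (\<lambda>p x. p (G p x))"
  by (rule recursive_comp[of "\<lambda>p. p", OF recursiveI[of QueryP]]) simp_all

lemma recursive_pr:
  assumes "recursive F" "recursive G" shows "recursive (\<lambda>p x. pr (F p x) (G p x))"
proof -
  obtain a b where "\<And>p x. run p a x = Some (F p x)" "\<And>p x. run p b x = Some (G p x)"
    using assms unfolding recursive_def by blast
  then show ?thesis by (intro recursiveI[of "PairP a b"]) simp
qed

lemma recursive_const: "recursive (\<lambda>p x. n)"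
proof (induction n)
  case 0
  show ?case by (rule recursive_zero)
next
  case (Suc n)
  then show ?case by (rule recursive_Suc)
qed

lemma recursive_rec:
  assumes "recursive A" "recursive N"
    and "recursive (\<lambda>p y. g p (pfst y) (pfst (psnd y)) (psnd (psnd y)))"
  shows "recursive (\<lambda>p x. rec_nat (A p x) (\<lambda>m r. g p x m r) (N p x))"
proof -
  obtain a n b where a: "\<And>p x. run p a x = Some (A p x)" and n: "\<And>p x. run p n x = Some (N p x)"
    and b: "\<And>p y. run p b y = Some (g p (pfst y) (pfst (psnd y)) (psnd (psnd y)))"
    using assms unfolding recursive_def by blast
  have "rec_nat (run p a x) (\<lambda>m r. Option.bind r (\<lambda>y. run p b (pr x (pr m y)))) k
      = Some (rec_nat (A p x) (\<lambda>m r. g p x m r) k)" for p x k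
    by (induction k) (simp_all add: a b)
  then show ?thesis
    by (intro recursiveI[of "CompP (RecP a b) (PairP (PairP FstP SndP) n)"]) (simp add: n)
qed

lemma recursive_if_zero:
  assumes "recursive T" "recursive A" "recursive B"
  shows "recursive (\<lambda>p x. if T p x = 0 then A p x else B p x)"
proof -
  have "(if t = 0 then u else v) = rec_nat u (\<lambda>m r. v) t" for t u v :: nat
    by (cases t) simp_all
  moreover have "recursive (\<lambda>p x. rec_nat (A p x) (\<lambda>m r. B p x) (T p x))"
    by (intro recursive_rec assms recursive_comp[OF assms(3)] recursive_pfst recursive_id)
  ultimately show ?thesis by simp
qed

lemma recursive_pred: "recursive G \<Longrightarrow> recursive (\<lambda>p x. G p x - 1)"
proof -
  assume G: "recursive G"
  have "k - 1 = rec_nat 0 (\<lambda>m r. m) k" for k :: nat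
    by (cases k) simp_all
  moreover have "recursive (\<lambda>p x. rec_nat 0 (\<lambda>m r. m) (G p x))"
    by (intro recursive_rec G recursive_zero recursive_pfst recursive_psnd recursive_id)
  ultimately show ?thesis by simp
qed

lemma recursive_diff:
  assumes "recursive F" "recursive G" shows "recursive (\<lambda>p x. F p x - G p x)"
proof -
  have "rec_nat a (\<lambda>m r. r - 1) k = a - k" for a k :: nat
    by (induction k) simp_all
  moreover have "recursive (\<lambda>p x. rec_nat (F p x) (\<lambda>m r. r - 1) (G p x))"
    by (intro recursive_rec assms recursive_pred recursive_psnd recursive_id)
  ultimately show ?thesis by simp
qed

lemmas recursive_intros =
  recursive_const recursive_id recursive_Suc recursive_pfst recursive_psnd recursive_pr
  recursive_if_zero recursive_diff

lemma recursive_comp2: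
  assumes "recursive (\<lambda>p y. f (pfst y) (psnd y))" "recursive F" "recursive G"
  shows "recursive (\<lambda>p x. f (F p x) (G p x))"
  using recursive_comp[OF assms(1) recursive_pr[OF assms(2,3)]] by simp

lemma computable_functional_recursive:
  assumes "recursive F" shows "computable_functional (\<lambda>p. Some (F p))"
proof -
  obtain c where "\<And>p x. run p c x = Some (F p x)"
    using assms unfolding recursive_def by blast
  then show ?thesis
    by (intro computable_functionalI[of _ c]) (auto simp: functional_eq_Some)
qed

text \<open>
  A program that halts only on \<open>A\<close> cannot be fed to the closure rules for total functions. Deciding
  \<open>A\<close> first makes it total: recursion of length 0 or 1 evaluates the program only on \<open>A\<close>. The zero
  oracle is substituted away so that the result is the same for every oracle.
\<close>

lemma recursive_on_decidable:
  assumes "decidable A" and "\<And>e. e \<in> A \<Longrightarrow> run (\<lambda>_. 0) r e = Some (f e)"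
  obtains g where "recursive (\<lambda>_. g)" "\<And>e. e \<in> A \<Longrightarrow> g e = f e"
proof -
  obtain d where d: "\<And>n. run (\<lambda>_. 0) d n = Some (if n \<in> A then 1 else 0)"
    using assms(1) unfolding decidable_def by blast
  let ?id = "PairP FstP SndP"
  let ?c = "CompP (RecP ZeroP (CompP r FstP)) (PairP ?id d)"
  have "run (\<lambda>_. 0) ?c e = Some (if e \<in> A then f e else 0)" for e
    using assms(2) by (simp add: d)
  then have "run p (subst ZeroP ?c) e = Some (if e \<in> A then f e else 0)" for p e
    by (subst run_subst[where q = "\<lambda>_. 0"]) simp_all
  then show thesis
    by (rule that[OF recursiveI]) simp
qed

section \<open>Course-of-values recursion and lists\<close>

text \<open>
  The history of the values at \<open>n - 1, \<dots>, 0\<close> is stored as a nested pair with the latest value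
  outermost; \<open>lookup n i h\<close> is the entry of \<open>i < n\<close> in such a history \<open>h\<close>.
\<close>

definition lookup :: "nat \<Rightarrow> nat \<Rightarrow> nat \<Rightarrow> nat" where
  "lookup n i h = pfst ((psnd ^^ (n - Suc i)) h)"

lemma recursive_lookup:
  assumes "recursive N" "recursive I" "recursive H"
  shows "recursive (\<lambda>p x. lookup (N p x) (I p x) (H p x))"
proof -
  have "(psnd ^^ k) h = rec_nat h (\<lambda>m r. psnd r) k" for k h
    by (induction k) simp_all
  moreover have "recursive (\<lambda>p x. pfst (rec_nat (H p x) (\<lambda>m r. psnd r) (N p x - Suc (I p x))))"
    by (intro recursive_intros recursive_rec assms)
  ultimately show ?thesis by (simp add: lookup_def)
qed

text \<open>
  The hypothesis on \<open>f\<close> speaks only of histories that are correct below \<open>n\<close>, so \<open>f\<close> may be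
  introduced by any recursion scheme whose calls descend.
\<close>

lemma recursive_course_of_values:
  assumes G: "recursive (\<lambda>_. G)"
    and f: "\<And>u n h. (\<And>i. i < n \<Longrightarrow> lookup n i h = f u i) \<Longrightarrow> f u n = G (pr u (pr n h))"
  shows "recursive (\<lambda>p y. f (pfst y) (psnd y))"
proof -
  define H where "H u n = rec_nat 0 (\<lambda>m h. pr (G (pr u (pr m h))) h) n" for u n
  have H: "lookup n i (H u n) = f u i" if "i < n" for u n i
    using that
  proof (induction n arbitrary: i)
    case (Suc n)
    have [simp]: "H u (Suc n) = pr (f u n) (H u n)"
      using f[of n "H u n" u] Suc.IH by (simp add: H_def)
    show ?case
    proof (cases "i = n")
      case False
      then have "n - i = Suc (n - Suc i)" using Suc.prems by simp
      then have "lookup (Suc n) i (H u (Suc n)) = lookup n i (H u n)"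
        by (simp add: lookup_def funpow_Suc_right del: funpow.simps)
      then show ?thesis using Suc False by simp
    qed (simp add: lookup_def)
  qed simp
  have "recursive (\<lambda>p y. G (pr (pfst y) (pr (psnd y) (H (pfst y) (psnd y)))))"
    unfolding H_def by (intro recursive_comp[OF G] recursive_intros recursive_rec)
  moreover have "f u n = G (pr u (pr n (H u n)))" for u n
    using f[of n "H u n" u] H by blast
  ultimately show ?thesis by simp
qed

text \<open>
  The code of the tail of a list is smaller than the code of the list, so a right fold is a
  course-of-values recursion on codes.
\<close>

lemma recursive_foldr:
  assumes s: "recursive (\<lambda>p y. s (pfst y) (psnd y))" and "recursive T" "recursive B"
  shows "recursive (\<lambda>p x. foldr s (list_decode (T p x)) (B p x))"
proof -
  let ?G = "\<lambda>y. if pfst (psnd y) = 0 then pfst y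
    else s (pfst (pfst (psnd y) - 1))
           (lookup (pfst (psnd y)) (psnd (pfst (psnd y) - 1)) (psnd (psnd y)))"
  have "recursive (\<lambda>p y. foldr s (list_decode (psnd y)) (pfst y))"
  proof (rule recursive_course_of_values)
    show "recursive (\<lambda>_. ?G)"
      by (intro recursive_intros recursive_comp2[OF s] recursive_lookup)
    show "foldr s (list_decode n) u = ?G (pr u (pr n h))"
      if "\<And>i. i < n \<Longrightarrow> lookup n i h = foldr s (list_decode i) u" for u n h
    proof (cases n)
      case (Suc m)
      have "psnd m < n"
        using le_prod_encode_2[of "psnd m" "pfst m"] Suc by simp
      then show ?thesis using that[of "psnd m"] Suc by (simp add: case_prod_beta)
    qed simp
  qed
  from recursive_comp2[OF this assms(3,2)] show ?thesis .
qed

section \<open>Substitution on indices\<close>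

lemma psnd_less:
  assumes "0 < pfst n" shows "psnd n < n"
proof -
  have "k \<le> triangle k" for k
    by (induction k) simp_all
  from this[of "pfst n + psnd n"] have "psnd n < triangle (pfst n + psnd n) + pfst n"
    using assms by linarith
  also have "\<dots> = pr (pfst n) (psnd n)"
    by (simp only: prod_encode_def prod.case)
  also have "\<dots> = n"
    by simp
  finally show ?thesis .
qed

text \<open>
  Effect of \<open>subst\<close> on indices. The truncated differences test the constructor tag: up to 3 are the
  constants, 4 is the oracle query, 5 to 7 are the binary constructors, and 8 is minimization.
\<close>

function subst_code :: "nat \<Rightarrow> nat \<Rightarrow> nat" where
  "subst_code d n =
     (if pfst n - 3 = 0 then n else if pfst n - 4 = 0 then d
      else if pfst n - 7 = 0
        then pr (pfst n) (pr (subst_code d (pfst (psnd n))) (subst_code d (psnd (psnd n))))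
      else pr (pfst n) (subst_code d (psnd n)))"
  by pat_completeness auto
termination
proof (relation "inv_image less_than snd", goal_cases)
  case (2 d n)
  then show ?case
    using psnd_less[of n] le_prod_encode_1[of "pfst (psnd n)" "psnd (psnd n)"] by simp
next
  case (3 d n)
  then show ?case
    using psnd_less[of n] le_prod_encode_2[of "psnd (psnd n)" "pfst (psnd n)"] by simp
next
  case (4 d n)
  then show ?case using psnd_less[of n] by simp
qed simp

declare subst_code.simps [simp del]

lemma subst_code_index_of: "subst_code (index_of d) (index_of c) = index_of (subst d c)"
  by (induction c) (subst subst_code.simps, simp)+

lemma recursive_subst_code:
  assumes "recursive F" "recursive G"
  shows "recursive (\<lambda>p x. subst_code (F p x) (G p x))"
proof -
  let ?n = "\<lambda>y. pfst (psnd y)"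
  let ?old = "\<lambda>y i. lookup (?n y) i (psnd (psnd y))"
  let ?G = "\<lambda>y. if pfst (?n y) - 3 = 0 then ?n y else if pfst (?n y) - 4 = 0 then pfst y
      else if pfst (?n y) - 7 = 0
        then pr (pfst (?n y)) (pr (?old y (pfst (psnd (?n y)))) (?old y (psnd (psnd (?n y)))))
      else pr (pfst (?n y)) (?old y (psnd (?n y)))"
  have "recursive (\<lambda>p y. subst_code (pfst y) (psnd y))"
  proof (rule recursive_course_of_values)
    show "recursive (\<lambda>_. ?G)"
      by (intro recursive_intros recursive_lookup)
    show "subst_code u n = ?G (pr u (pr n h))"
      if old: "\<And>i. i < n \<Longrightarrow> lookup n i h = subst_code u i" for u n h
    proof (cases "pfst n - 3 = 0")
      case False
      then have less: "psnd n < n" by (intro psnd_less) simp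
      then have "pfst (psnd n) < n" "psnd (psnd n) < n"
        using le_prod_encode_1[of "pfst (psnd n)" "psnd (psnd n)"]
          le_prod_encode_2[of "psnd (psnd n)" "pfst (psnd n)"] by simp_all
      with less show ?thesis by (subst subst_code.simps) (simp add: old)
    qed (subst subst_code.simps, simp)
  qed
  from recursive_comp2[OF this assms] show ?thesis .
qed

section \<open>Names of concatenated transcripts\<close>

text \<open>
  A name of a concatenated list has the columns of the second part moved up by the length of the
  first part. \<open>shift_prog is\<close> answers queries to the second part. It depends on a list, and not on a
  number, because its index can then be computed by a fold over the list code.
\<close>

definition shift_prog :: "'a list \<Rightarrow> prog" where
  "shift_prog is = CompP QueryP (PairP (foldr (\<lambda>_. CompP SuccP) is FstP) SndP)"

text \<open>
  If \<open>a\<close> computes a name of the head from the first \<open>length is\<close> columns of the oracle, and \<open>d\<close> computes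
  a name of the tail from the other columns, then \<open>cons_prog is a d\<close> computes a name of the whole list.
  On input \<open>pr j n\<close> it recurses on the column number \<open>j\<close>: the recursion starts with \<open>a\<close> on \<open>n\<close>, and its
  step ignores the previous value and runs \<open>d\<close> on column \<open>j - 1\<close>.
\<close>

definition cons_prog :: "'a list \<Rightarrow> prog \<Rightarrow> prog \<Rightarrow> prog" where
  "cons_prog is a d =
     CompP (RecP a (CompP (subst (shift_prog is) d) (PairP (CompP FstP SndP) FstP))) (PairP SndP FstP)"

abbreviation shift :: "nat \<Rightarrow> baire \<Rightarrow> baire" where
  "shift k p \<equiv> (\<lambda>m. p (pr (pfst m + k) (psnd m)))"

lemma functional_shift_prog: "functional (shift_prog is) p = Some (shift (length is) p)"
proof -
  have "run p (foldr (\<lambda>_. CompP SuccP) is FstP) m = Some (pfst m + length is)" for m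
    by (induction "is") simp_all
  then show ?thesis by (simp add: functional_eq_Some shift_prog_def)
qed

lemma functional_cons_prog:
  assumes a: "functional a p = Some q" and d: "functional d (shift (length is) p) = Some q'"
  shows "functional (cons_prog is a d) p
    = Some (\<lambda>m. if pfst m = 0 then q (psnd m) else q' (pr (pfst m - 1) (psnd m)))"
proof -
  have d': "run p (subst (shift_prog is) d) m = Some (q' m)" for m
    using functional_subst[OF functional_shift_prog, of "is" d p] d
    by (simp add: functional_eq_Some)
  have "rec_nat (run p a u) (\<lambda>m r. Option.bind r (\<lambda>y. Some (q' (pr m u)))) j
      = Some (if j = 0 then q u else q' (pr (j - 1) u))" for j u
    using a by (induction j) (simp_all add: functional_eq_Some)
  then show ?thesis by (simp add: functional_eq_Some cons_prog_def d')
qed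

lemma list_rep_eq_Some:
  "list_rep \<delta>s p = Some vs \<longleftrightarrow>
     length vs = length \<delta>s \<and> (\<forall>j<length \<delta>s. (\<delta>s ! j) (col p j) = Some (vs ! j))"
proof
  assume "list_rep \<delta>s p = Some vs"
  then show "length vs = length \<delta>s \<and> (\<forall>j<length \<delta>s. (\<delta>s ! j) (col p j) = Some (vs ! j))"
    by (auto simp: list_rep_def split: if_splits)
next
  assume vs: "length vs = length \<delta>s \<and> (\<forall>j<length \<delta>s. (\<delta>s ! j) (col p j) = Some (vs ! j))"
  then have "map (\<lambda>j. the ((\<delta>s ! j) (col p j))) [0..<length \<delta>s] = vs"
    by (intro nth_equalityI) simp_all
  with vs show "list_rep \<delta>s p = Some vs"
    by (simp add: list_rep_def)
qed

lemma col_shift: "col (shift k p) j = col p (j + k)"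
  by (simp add: col_def)

lemma list_rep_append:
  assumes "list_rep (\<delta>s @ \<epsilon>s) p = Some (vs @ ws)" "length vs = length \<delta>s"
  shows "list_rep \<delta>s p = Some vs" "list_rep \<epsilon>s (shift (length \<delta>s) p) = Some ws"
proof -
  have *: "((\<delta>s @ \<epsilon>s) ! j) (col p j) = Some ((vs @ ws) ! j)" if "j < length \<delta>s + length \<epsilon>s" for j
    using assms that by (simp add: list_rep_eq_Some)
  show "list_rep \<delta>s p = Some vs"
    unfolding list_rep_eq_Some
  proof (intro conjI allI impI)
    fix j assume "j < length \<delta>s"
    then show "(\<delta>s ! j) (col p j) = Some (vs ! j)"
      using *[of j] assms(2) by (simp add: nth_append)
  qed (rule assms(2))
  show "list_rep \<epsilon>s (shift (length \<delta>s) p) = Some ws"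
    using assms *[of "j + length \<delta>s" for j]
    by (simp add: list_rep_eq_Some col_shift nth_append)
qed

lemma list_rep_Cons:
  assumes "\<delta> q = Some v" "list_rep \<delta>s q' = Some vs"
  shows "list_rep (\<delta> # \<delta>s)
      (\<lambda>m. if pfst m = 0 then q (psnd m) else q' (pr (pfst m - 1) (psnd m))) = Some (v # vs)"
  unfolding list_rep_eq_Some
proof (intro conjI allI impI)
  fix j assume "j < length (\<delta> # \<delta>s)"
  then show "((\<delta> # \<delta>s) ! j) (col (\<lambda>m. if pfst m = 0 then q (psnd m) else q' (pr (pfst m - 1) (psnd m))) j)
      = Some ((v # vs) ! j)"
    using assms by (cases j) (simp_all add: list_rep_eq_Some col_def)
qed (use assms in \<open>simp add: list_rep_eq_Some\<close>)

definition transcript_prog :: "(nat \<Rightarrow> nat list) \<Rightarrow> (nat \<Rightarrow> prog) \<Rightarrow> nat list \<Rightarrow> prog" where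
  "transcript_prog L c is = foldr (\<lambda>i. cons_prog (L i) (c i)) is ZeroP"

text \<open>
  From a name of the transcript of \<open>x\<close> for the concatenated query lists, the inner reconstructions
  compute a name of the transcript of \<open>y\<close>. Induction on the list with the oracle generalized: the
  head consumes a prefix of the columns, and the remaining programs see the shifted oracle.
\<close>

lemma list_rep_transcript_prog:
  assumes c: "\<And>i. i \<in> idx P \<Longrightarrow>
      realizes_partial (c i) (list_rep (map (val_rep S) (L i))) (val_rep P i) (\<theta> i)"
    and \<theta>: "\<And>i. i \<in> idx P \<Longrightarrow> \<theta> i (transcript S (L i) x) = Some (eval_at P i y)"
    and "set is \<subseteq> idx P"
    and "list_rep (map (val_rep S) (concat (map L is))) p
      = Some (transcript S (concat (map L is)) x)"
  shows "\<exists>q. functional (transcript_prog L c is) p = Some q \<and>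
    list_rep (map (val_rep P) is) q = Some (transcript P is y)"
  using assms(3,4)
proof (induction "is" arbitrary: p)
  case Nil
  show ?case by (simp add: transcript_prog_def functional_def list_rep_def transcript_def)
next
  case (Cons i "is")
  have app: "list_rep (map (val_rep S) (L i) @ map (val_rep S) (concat (map L is))) p
      = Some (transcript S (L i) x @ transcript S (concat (map L is)) x)"
    using Cons.prems by (simp add: transcript_def)
  have len: "length (transcript S (L i) x) = length (map (val_rep S) (L i))"
    by (simp add: transcript_def)
  obtain q where q: "functional (c i) p = Some q" "val_rep P i q = Some (eval_at P i y)"
    using c[of i, unfolded realizes_partial_def, rule_format, OF _ conjI,
        OF _ list_rep_append(1)[OF app len] \<theta>] Cons.prems(1)
    by auto
  obtain q' where q': "functional (transcript_prog L c is) (shift (length (L i)) p) = Some q'"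
      "list_rep (map (val_rep P) is) q' = Some (transcript P is y)"
    using Cons.IH[OF _ list_rep_append(2)[OF app len, unfolded length_map]] Cons.prems(1)
    by auto
  show ?case
    using functional_cons_prog[OF q(1) q'(1)] list_rep_Cons[of "val_rep P i", OF q(2) q'(2)]
    by (simp add: transcript_prog_def transcript_def)
qed

lemma foldr_index_of: "index_of (foldr (\<lambda>_. CompP SuccP) is FstP)
    = foldr (\<lambda>_ r. pr 6 (pr (pr 1 0) r)) is (pr 2 0)"
  by (induction "is") simp_all

lemma index_of_shift_prog:
  "index_of (shift_prog is) =
     pr 6 (pr (pr 4 0) (pr 5 (pr (foldr (\<lambda>_ r. pr 6 (pr (pr 1 0) r)) is (pr 2 0)) (pr 3 0))))"
  by (simp only: shift_prog_def index_of.simps foldr_index_of)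

text \<open>
  Concatenated query list and program index are computed together by one fold over the code of the
  list. All operations used by a step, namely appending, \<open>shift_prog\<close> and \<open>cons_prog\<close>, are available
  on codes.
\<close>

lemma recursive_transcript_prog:
  assumes f: "recursive (\<lambda>_. f)"
    and f_eq: "\<And>i. i \<in> I \<Longrightarrow> f i = pr (list_encode (L i)) (index_of (c i))"
  obtains g where "recursive (\<lambda>_. g)"
    "\<And>is. set is \<subseteq> I \<Longrightarrow> g (list_encode is) =
       pr (list_encode (concat (map L is))) (index_of (transcript_prog L c is))"
proof -
  define shift_code where "shift_code t =
    pr 6 (pr (pr 4 0) (pr 5 (pr (foldr (\<lambda>_ r. pr 6 (pr (pr 1 0) r)) (list_decode t) (pr 2 0)) (pr 3 0))))"
    for t
  define append_code where "append_code t u = foldr (\<lambda>x r. Suc (pr x r)) (list_decode t) u" for t u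
  define cons_code where "cons_code t a d =
    pr 6 (pr (pr 7 (pr a (pr 6 (pr (subst_code (shift_code t) d)
      (pr 5 (pr (pr 6 (pr (pr 2 0) (pr 3 0))) (pr 2 0))))))) (pr 5 (pr (pr 3 0) (pr 2 0))))" for t a d
  define step where "step i r =
    pr (append_code (pfst (f i)) (pfst r)) (cons_code (pfst (f i)) (psnd (f i)) (psnd r))" for i r
  define g where "g t = foldr step (list_decode t) (pr 0 (index_of ZeroP))" for t
  have append: "append_code (list_encode xs) (list_encode ys) = list_encode (xs @ ys)" for xs ys
    unfolding append_code_def by (induction xs) simp_all
  have cons: "cons_code (list_encode xs) (index_of a) (index_of d) = index_of (cons_prog xs a d)"
    for xs :: "nat list" and a d
    unfolding cons_code_def shift_code_def cons_prog_def
    by (simp only: index_of_shift_prog[symmetric] list_encode_inverse subst_code_index_of index_of.simps)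
  have rec_shift: "recursive (\<lambda>p y. shift_code (T p y))" if "recursive T" for T
    unfolding shift_code_def by (intro recursive_intros recursive_foldr that)
  have rec_append: "recursive (\<lambda>p y. append_code (T p y) (U p y))"
    if "recursive T" "recursive U" for T U
    unfolding append_code_def by (intro recursive_intros recursive_foldr that)
  have rec_cons: "recursive (\<lambda>p y. cons_code (T p y) (A p y) (D p y))"
    if "recursive T" "recursive A" "recursive D" for T A D
    unfolding cons_code_def by (intro recursive_intros recursive_subst_code rec_shift that)
  have "recursive (\<lambda>p y. step (pfst y) (psnd y))"
    unfolding step_def
    by (intro recursive_intros rec_append rec_cons recursive_comp[OF f])
  then have "recursive (\<lambda>_. g)"
    unfolding g_def by (intro recursive_intros recursive_foldr)
  moreover have "g (list_encode is) =
      pr (list_encode (concat (map L is))) (index_of (transcript_prog L c is))" if "set is \<subseteq> I" for "is"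
    using that unfolding g_def
    by (induction "is") (simp_all add: step_def f_eq append cons transcript_prog_def)
  ultimately show thesis by (rule that)
qed

section \<open>Limit computability absorbs computable functionals\<close>

text \<open>
  Total approximation at stage \<open>s\<close> of the semantics: minimization is the only source of divergence,
  and here it searches only below \<open>s\<close>. Successful searches are stored as successors so that 0 can mean
  that nothing has been found yet. Values of diverging computations are arbitrary; only convergence to
  the correct value of halting computations matters.
\<close>

primrec approx :: "nat \<Rightarrow> baire \<Rightarrow> prog \<Rightarrow> nat \<Rightarrow> nat" where
  "approx s p ZeroP x = 0"
| "approx s p SuccP x = Suc x"
| "approx s p FstP x = pfst x"
| "approx s p SndP x = psnd x"
| "approx s p QueryP x = p x"
| "approx s p (PairP a b) x = pr (approx s p a x) (approx s p b x)"
| "approx s p (CompP a b) x = approx s p a (approx s p b x)"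
| "approx s p (RecP a b) x =
     rec_nat (approx s p a (pfst x)) (\<lambda>m y. approx s p b (pr (pfst x) (pr m y))) (psnd x)"
| "approx s p (MuP a) x =
     rec_nat 0 (\<lambda>m r. if r = 0 then if approx s p a (pr x m) = 0 then Suc m else 0 else r) s - 1"

lemma bounded_search:
  assumes "g n = (0 :: nat)" "\<And>m. m < n \<Longrightarrow> g m \<noteq> 0"
  shows "rec_nat 0 (\<lambda>m r. if r = 0 then if g m = 0 then Suc m else 0 else r) s
    = (if n < s then Suc n else 0)"
proof (induction s)
  case (Suc s)
  then show ?case
    using assms by (cases s n rule: linorder_cases) auto
qed simp

text \<open>
  A halting computation is a finite tree with finitely many oracle queries and finitely many searches.
  Once the oracles \<open>P s\<close> agree with \<open>q\<close> on these queries and \<open>s\<close> exceeds all values that were found, the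
  approximation is exact.
\<close>

lemma eventually_approx:
  assumes lim: "\<And>n. \<forall>\<^sub>F s in sequentially. P s n = q n"
  shows "run q c x = Some y \<Longrightarrow> \<forall>\<^sub>F s in sequentially. approx s (P s) c x = y"
proof (induction c arbitrary: x y)
  case QueryP
  then show ?case using lim[of x] by simp
next
  case (PairP a b)
  obtain u v where uv: "run q a x = Some u" "run q b x = Some v" "y = pr u v"
    using PairP.prems by (auto simp: bind_eq_Some_conv)
  from PairP.IH(1)[OF uv(1)] PairP.IH(2)[OF uv(2)] show ?case
    by eventually_elim (simp add: uv(3))
next
  case (CompP a b)
  obtain u where u: "run q b x = Some u" "run q a u = Some y"
    using CompP.prems by (auto simp: bind_eq_Some_conv)
  from CompP.IH(2)[OF u(1)] CompP.IH(1)[OF u(2)] show ?case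
    by eventually_elim simp
next
  case (RecP a b)
  let ?u = "pfst x"
  let ?R = "rec_nat (run q a ?u) (\<lambda>m r. Option.bind r (\<lambda>y. run q b (pr ?u (pr m y))))"
  let ?A = "\<lambda>s. rec_nat (approx s (P s) a ?u) (\<lambda>m y. approx s (P s) b (pr ?u (pr m y)))"
  have "?R k = Some v \<Longrightarrow> \<forall>\<^sub>F s in sequentially. ?A s k = v" for k v
  proof (induction k arbitrary: v)
    case 0
    then show ?case using RecP.IH(1)[of ?u v] by simp
  next
    case (Suc k)
    obtain w where w: "?R k = Some w" "run q b (pr ?u (pr k w)) = Some v"
      using Suc.prems by (auto simp: bind_eq_Some_conv)
    from Suc.IH[OF w(1)] RecP.IH(2)[OF w(2)] show ?case
      by eventually_elim simp
  qed
  then show ?case using RecP.prems by (simp add: case_prod_beta)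
next
  case (MuP a)
  let ?Z = "\<lambda>n. run q a (pr x n) = Some 0"
  obtain n where n: "?Z n" "\<forall>m<n. run q a (pr x m) \<noteq> None" and y: "y = (LEAST n. ?Z n)"
    using MuP.prems by (auto split: if_splits)
  have Zy: "?Z y" unfolding y by (rule LeastI[of ?Z, OF n(1)])
  have yn: "y \<le> n" unfolding y by (rule Least_le[of ?Z, OF n(1)])
  have "\<forall>\<^sub>F s in sequentially. approx s (P s) a (pr x m) \<noteq> 0" if m: "m < y" for m
  proof -
    obtain v where v: "run q a (pr x m) = Some v"
      using n(2) yn m by force
    have "\<not> ?Z m"
      using m not_less_Least[of m ?Z] y by simp
    with v have "v \<noteq> 0" by auto
    then show ?thesis
      by (intro eventually_mono[OF MuP.IH[OF v]]) simp
  qed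
  then have "\<forall>\<^sub>F s in sequentially. \<forall>m\<in>{..<y}. approx s (P s) a (pr x m) \<noteq> 0"
    by (intro eventually_ball_finite finite_lessThan) blast
  with MuP.IH[OF Zy] eventually_gt_at_top[of y] show ?case
  proof eventually_elim
    case (elim s)
    then show ?case
      using bounded_search[of "\<lambda>m. approx s (P s) a (pr x m)" y s] by simp
  qed
qed simp_all

lemma recursive_approx: "recursive (\<lambda>P x. approx (pfst x) (col P (pfst x)) c (psnd x))"
proof (induction c)
  case QueryP
  show ?case
    unfolding col_def approx.simps by (intro recursive_query recursive_intros)
next
  case (CompP a b)
  show ?case
    using recursive_comp[OF CompP.IH(1) recursive_pr[OF recursive_pfst[OF recursive_id] CompP.IH(2)]]
    by simp
next
  case (RecP a b)
  let ?a = "\<lambda>P x. approx (pfst x) (col P (pfst x)) a (pfst (psnd x))"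
  let ?b = "\<lambda>P x m y. approx (pfst x) (col P (pfst x)) b (pr (pfst (psnd x)) (pr m y))"
  have a: "recursive ?a"
    using recursive_comp[OF RecP.IH(1), of "\<lambda>P x. pr (pfst x) (pfst (psnd x))"]
    by (simp add: recursive_intros)
  have b: "recursive (\<lambda>P y. ?b P (pfst y) (pfst (psnd y)) (psnd (psnd y)))"
    using recursive_comp[OF RecP.IH(2), of "\<lambda>P y. pr (pfst (pfst y))
      (pr (pfst (psnd (pfst y))) (pr (pfst (psnd y)) (psnd (psnd y))))"]
    by (simp add: recursive_intros)
  show ?case
    using recursive_rec[OF a _ b, of "\<lambda>P x. psnd (psnd x)"] by (simp add: recursive_intros)
next
  case (MuP a)
  let ?a = "\<lambda>P x m r. if r = 0 then
      if approx (pfst x) (col P (pfst x)) a (pr (psnd x) m) = 0 then Suc m else 0 else r"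
  have a: "recursive (\<lambda>P y. approx (pfst (pfst y)) (col P (pfst (pfst y))) a
      (pr (psnd (pfst y)) (pfst (psnd y))))"
    using recursive_comp[OF MuP.IH, of "\<lambda>P y. pr (pfst (pfst y))
      (pr (psnd (pfst y)) (pfst (psnd y)))"]
    by (simp add: recursive_intros)
  have "recursive (\<lambda>P x. rec_nat 0 (\<lambda>m r. ?a P x m r) (pfst x) - 1)"
    by (intro recursive_intros recursive_rec a)
  then show ?case by simp
qed (simp_all add: recursive_intros)

lemma Lim_eq_SomeI:
  assumes "\<And>j. \<forall>\<^sub>F s in sequentially. P (pr s j) = q j" shows "Lim P = Some q"
proof -
  have "(THE v. \<forall>\<^sub>F s in sequentially. P (pr s j) = v) = q j" for j
  proof (rule the_equality[where P = "\<lambda>v. \<forall>\<^sub>F s in sequentially. P (pr s j) = v"])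
    fix v assume "\<forall>\<^sub>F s in sequentially. P (pr s j) = v"
    with assms[of j] have "\<forall>\<^sub>F s in sequentially. v = q j"
      by eventually_elim simp
    then show "v = q j" by simp
  qed (rule assms)
  moreover have "\<forall>j. \<exists>v. \<forall>\<^sub>F s in sequentially. P (pr s j) = v"
    using assms by blast
  ultimately show ?thesis by (simp add: Lim_def)
qed

lemma Lim_eq_SomeD:
  assumes "Lim P = Some q" shows "\<forall>\<^sub>F s in sequentially. P (pr s j) = q j"
proof -
  have *: "\<forall>j. \<exists>v. \<forall>\<^sub>F s in sequentially. P (pr s j) = v"
    using assms unfolding Lim_def by (auto split: if_splits)
  then obtain q' where q': "\<And>j. \<forall>\<^sub>F s in sequentially. P (pr s j) = q' j" by metis
  with Lim_eq_SomeI[of P q'] assms show ?thesis by simp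
qed

text \<open>
  Column \<open>s\<close> of \<open>J P\<close> is the stage \<open>s\<close> approximation of the program for \<open>H\<close>, run with column \<open>s\<close> of
  \<open>P\<close> as oracle. It is total, and it converges to \<open>H (Lim P)\<close> wherever the latter exists.
\<close>

lemma Lim_absorbs_computable:
  assumes "computable_functional H"
  shows "\<exists>J. computable_functional J \<and>
    (\<forall>P q r. Lim P = Some q \<longrightarrow> H q = Some r \<longrightarrow> Option.bind (J P) Lim = Some r)"
proof -
  obtain c where c: "\<And>p q. H p = Some q \<Longrightarrow> functional c p = Some q"
    using computable_functionalD[OF assms] by blast
  let ?J = "\<lambda>P x. approx (pfst x) (col P (pfst x)) c (psnd x)"
  have "Lim (?J P) = Some r" if "Lim P = Some q" "H q = Some r" for P q r
  proof (rule Lim_eq_SomeI)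
    fix j
    have "run q c j = Some (r j)"
      using c[OF that(2)] by (simp add: functional_eq_Some)
    then show "\<forall>\<^sub>F s in sequentially. ?J P (pr s j) = r j"
      using eventually_approx[where P = "col P" and q = q] Lim_eq_SomeD[OF that(1)]
      by (simp add: col_def)
  qed
  then show ?thesis
    using computable_functional_recursive[OF recursive_approx]
    by (intro exI[of _ "\<lambda>P. Some (?J P)"]) simp
qed

lemma Lim_pow_absorbs_computable:
  assumes "computable_functional H"
  shows "\<exists>J. computable_functional J \<and>
    (\<forall>P q r. Lim_pow k P = Some q \<longrightarrow> H q = Some r \<longrightarrow> Option.bind (J P) (Lim_pow k) = Some r)"
  using assms
proof (induction k arbitrary: H)
  case 0
  then show ?case by auto
next
  case (Suc k)
  obtain J where J: "computable_functional J"
    "\<And>P q r. Lim P = Some q \<Longrightarrow> H q = Some r \<Longrightarrow> Option.bind (J P) Lim = Some r"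
    using Lim_absorbs_computable[OF Suc.prems] by blast
  obtain J' where J': "computable_functional J'"
    "\<And>P q r. Lim_pow k P = Some q \<Longrightarrow> J q = Some r \<Longrightarrow> Option.bind (J' P) (Lim_pow k) = Some r"
    using Suc.IH[OF J(1)] by blast
  have "Option.bind (J' P) (Lim_pow (Suc k)) = Some r"
    if lim: "Lim_pow (Suc k) P = Some q" and H: "H q = Some r" for P q r
  proof -
    obtain q0 where q0: "Lim_pow k P = Some q0" "Lim q0 = Some q"
      using lim by (auto simp: bind_eq_Some_conv)
    obtain P1 where P1: "J q0 = Some P1" "Lim P1 = Some r"
      using J(2)[OF q0(2) H] by (auto simp: bind_eq_Some_conv)
    show ?thesis
      using J'(2)[OF q0(1) P1(1)] P1(2) by (auto simp: bind_eq_Some_conv)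
  qed
  with J'(1) show ?case by blast
qed

section \<open>Strong and ordinary Weihrauch reductions\<close>

lemma col_bpair: "col (bpair p q) 0 = p" "col (bpair p q) (Suc i) = q"
  by (simp_all add: col_def bpair_def)

lemma computable_functional_col: "computable_functional (\<lambda>r. Some (col r i))"
  unfolding col_def by (intro computable_functional_recursive recursive_query recursive_intros)

text \<open>
  Replaces the first half of a pair by its image under \<open>K\<close>. A postprocessor of a Weihrauch reduction
  receives the original input in this half, and needs this step when it is used behind another
  preprocessor.
\<close>

lemma computable_functional_bpair:
  assumes "computable_functional K"
  shows "computable_functional (\<lambda>r. map_option (\<lambda>p. bpair p (col r 1)) (K (col r 0)))"
proof -
  have K0: "computable_functional (\<lambda>r. K (col r 0))"
    using computable_functional_bind[OF computable_functional_col[of 0] assms] by simp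
  obtain c where c: "\<And>r p. K (col r 0) = Some p \<Longrightarrow> functional c r = Some p"
    using computable_functionalD[OF K0] by blast
  let ?q = "CompP QueryP (PairP (CompP SuccP ZeroP) FstP)"
  let ?c = "CompP (RecP c ?q) (PairP SndP FstP)"
  show ?thesis
  proof (rule computable_functionalI)
    fix r s assume "map_option (\<lambda>p. bpair p (col r 1)) (K (col r 0)) = Some s"
    then obtain p where p: "K (col r 0) = Some p" "s = bpair p (col r 1)" by auto
    have run_c: "run r c n = Some (p n)" for n
      using c[OF p(1)] by (simp add: functional_eq_Some)
    have "rec_nat (run r c n) (\<lambda>m z. Option.bind z (\<lambda>y. Some (r (pr 1 n)))) i
        = Some (if i = 0 then p n else r (pr 1 n))" for i n
      by (induction i) (simp_all add: run_c)
    then show "functional ?c r = Some s"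
      by (simp add: functional_eq_Some p(2) bpair_def col_def case_prod_beta)
  qed
qed

lemma sW_le_imp_W_le:
  assumes "sW_le f g" shows "W_le f g"
proof -
  obtain K H where KH: "computable_functional K" "computable_functional H"
    "\<And>G. realizer g G \<Longrightarrow> realizer f (\<lambda>p. Option.bind (Option.bind (K p) G) H)"
    using assms unfolding sW_le_def by blast
  let ?H = "\<lambda>r. Option.bind (Some (col r 1)) H"
  have "computable_functional ?H"
    by (rule computable_functional_bind[OF computable_functional_col KH(2)])
  moreover have "?H (bpair p q) = H q" for p q
    by (simp add: col_bpair)
  ultimately show ?thesis
    using KH unfolding W_le_def by (intro exI[of _ K] exI[of _ ?H]) simp
qed

lemma sW_W_trans:
  assumes "sW_le f g" "W_le g h" shows "W_le f h"
proof -
  obtain K H where KH: "computable_functional K" "computable_functional H"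
    "\<And>G. realizer g G \<Longrightarrow> realizer f (\<lambda>p. Option.bind (Option.bind (K p) G) H)"
    using assms(1) unfolding sW_le_def by blast
  obtain K' H' where KH': "computable_functional K'" "computable_functional H'"
    "\<And>G. realizer h G \<Longrightarrow>
       realizer g (\<lambda>p. Option.bind (Option.bind (K' p) G) (\<lambda>q. H' (bpair p q)))"
    using assms(2) unfolding W_le_def by blast
  let ?K = "\<lambda>p. Option.bind (K p) K'"
  let ?H = "\<lambda>r. Option.bind (Option.bind (map_option (\<lambda>p. bpair p (col r 1)) (K (col r 0))) H') H"
  have "computable_functional ?K" "computable_functional ?H"
    by (intro computable_functional_bind computable_functional_bpair KH(1,2) KH'(1,2))+
  moreover have "realizer f (\<lambda>p. Option.bind (Option.bind (?K p) G) (\<lambda>q. ?H (bpair p q)))"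
    if "realizer h G" for G
  proof -
    have "(\<lambda>p. Option.bind (Option.bind (?K p) G) (\<lambda>q. ?H (bpair p q))) =
      (\<lambda>p. Option.bind (Option.bind (K p)
         (\<lambda>p. Option.bind (Option.bind (K' p) G) (\<lambda>q. H' (bpair p q)))) H)"
    proof
      fix p
      show "Option.bind (Option.bind (?K p) G) (\<lambda>q. ?H (bpair p q)) =
        Option.bind (Option.bind (K p)
         (\<lambda>p. Option.bind (Option.bind (K' p) G) (\<lambda>q. H' (bpair p q)))) H"
        by (cases "K p") (simp_all add: col_bpair)
    qed
    then show ?thesis using KH(3)[OF KH'(3)[OF that]] by simp
  qed
  ultimately show ?thesis unfolding W_le_def by blast
qed

lemma rk_lim_mono: "sW_le f g \<Longrightarrow> rk_lim f \<le> rk_lim g"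
  unfolding rk_lim_def by (intro Inf_superset_mono) (auto intro: sW_W_trans)

section \<open>Raw transports\<close>

lemma raw_transportD:
  assumes "raw_transport S P E D L \<theta>"
  shows "x \<in> inst S \<Longrightarrow> E x \<in> inst P"
    and "continuous_map (mtopology_of (met P)) (mtopology_of (met S)) D"
    and "e \<in> idx P \<Longrightarrow> set (L e) \<subseteq> idx S"
    and "x \<in> inst S \<Longrightarrow> target P (E x) \<noteq> {}"
    and "x \<in> inst S \<Longrightarrow> D ` target P (E x) \<subseteq> target S x"
    and "x \<in> inst S \<Longrightarrow> e \<in> idx P \<Longrightarrow> eval_at P e (E x) = \<theta> e (transcript S (L e) x)"
proof -
  note tr = assms[unfolded raw_transport_def]
  show "x \<in> inst S \<Longrightarrow> E x \<in> inst P" using tr by blast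
  show "continuous_map (mtopology_of (met P)) (mtopology_of (met S)) D" using tr by blast
  show "e \<in> idx P \<Longrightarrow> set (L e) \<subseteq> idx S" using tr by blast
  show "x \<in> inst S \<Longrightarrow> target P (E x) \<noteq> {}" using tr by blast
  show "x \<in> inst S \<Longrightarrow> D ` target P (E x) \<subseteq> target S x" using tr by blast
  show "x \<in> inst S \<Longrightarrow> e \<in> idx P \<Longrightarrow> eval_at P e (E x) = \<theta> e (transcript S (L e) x)"
    using tr by blast
qed

lemma raw_transport_refl:
  assumes "sci_problem S" shows "raw_transport S S (\<lambda>x. x) (\<lambda>v. v) (\<lambda>e. [e]) (\<lambda>e. hd)"
  unfolding raw_transport_def
proof (intro conjI ballI funcsetI)
  fix x assume "x \<in> inst S"
  then have "target S x \<noteq> {}"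
    using assms unfolding sci_problem_def by blast
  then show "(\<lambda>v. v) ` target S x \<noteq> {}" by simp
qed (simp_all add: transcript_def)

lemma raw_leI: "raw_transport S P E D L \<theta> \<Longrightarrow> raw_le S P"
  unfolding raw_le_def by blast

lemma raw_le_refl: "sci_problem S \<Longrightarrow> raw_le S S"
  by (rule raw_leI, rule raw_transport_refl)

text \<open>
  The composed reconstruction exists because the transcript of \<open>x\<close> for the concatenated list determines
  all transcripts for the inner lists, hence the transcript of \<open>E x\<close>, hence the evaluation of
  \<open>E' (E x)\<close>. An explicit decomposition of lists is avoided by choosing any function that factors
  through the transcript.
\<close>

lemma raw_transport_trans:
  assumes SP: "raw_transport S P E D L \<theta>" and PR: "raw_transport P R E' D' L' \<theta>'"
  shows "\<exists>\<eta>. raw_transport S R (\<lambda>x. E' (E x)) (\<lambda>v. D (D' v)) (\<lambda>e. concat (map L (L' e))) \<eta>"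
proof -
  let ?L = "\<lambda>e. concat (map L (L' e))"
  note SP = raw_transportD[OF SP] and PR = raw_transportD[OF PR]
  have determined: "eval_at R e (E' (E x)) = eval_at R e (E' (E y))"
    if e: "e \<in> idx R" and x: "x \<in> inst S" and y: "y \<in> inst S"
      and same: "transcript S (?L e) x = transcript S (?L e) y" for e x y
  proof -
    have "eval_at P i (E x) = eval_at P i (E y)" if i: "i \<in> set (L' e)" for i
    proof -
      have "transcript S (L i) x = transcript S (L i) y"
        using same i by (auto simp: transcript_def)
      moreover have "i \<in> idx P" using PR(3)[OF e] i by blast
      ultimately show ?thesis using SP(6)[OF x] SP(6)[OF y] by simp
    qed
    then have "transcript P (L' e) (E x) = transcript P (L' e) (E y)"
      by (simp add: transcript_def)
    then show ?thesis using PR(6)[OF SP(1)[OF x] e] PR(6)[OF SP(1)[OF y] e] by simp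
  qed
  have "\<exists>h. \<forall>x. x \<in> inst S \<longrightarrow> eval_at R e (E' (E x)) = h (transcript S (?L e) x)"
    if "e \<in> idx R" for e
    unfolding function_factors_left_gen[symmetric] using determined[OF that] by blast
  then obtain \<eta> where
    \<eta>: "\<And>e x. e \<in> idx R \<Longrightarrow> x \<in> inst S \<Longrightarrow> eval_at R e (E' (E x)) = \<eta> e (transcript S (?L e) x)"
    by metis
  have "raw_transport S R (\<lambda>x. E' (E x)) (\<lambda>v. D (D' v)) ?L \<eta>"
    unfolding raw_transport_def
  proof (intro conjI ballI funcsetI)
    show "continuous_map (mtopology_of (met R)) (mtopology_of (met S)) (\<lambda>v. D (D' v))"
      using continuous_map_compose[OF PR(2) SP(2)] by (simp add: comp_def)
  next
    fix e assume "e \<in> idx R"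
    from PR(3)[OF this] SP(3) show "set (?L e) \<subseteq> idx S" by fastforce
  next
    fix x assume x: "x \<in> inst S"
    show "E' (E x) \<in> inst R" by (rule PR(1)[OF SP(1)[OF x]])
    show "(\<lambda>v. D (D' v)) ` target R (E' (E x)) \<noteq> {}"
      using PR(4)[OF SP(1)[OF x]] by simp
    show "(\<lambda>v. D (D' v)) ` target R (E' (E x)) \<subseteq> target S x"
      using PR(5)[OF SP(1)[OF x]] SP(5)[OF x] by blast
    fix e assume "e \<in> idx R"
    then show "eval_at R e (E' (E x)) = \<eta> e (transcript S (?L e) x)"
      using x by (rule \<eta>)
  qed
  then show ?thesis by blast
qed

lemma raw_le_trans:
  assumes "raw_le S P" "raw_le P R" shows "raw_le S R"
proof -
  obtain E D L \<theta> E' D' L' \<theta>' where "raw_transport S P E D L \<theta>" "raw_transport P R E' D' L' \<theta>'"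
    using assms unfolding raw_le_def by (elim exE)
  from raw_transport_trans[OF this] obtain \<eta> where
    "raw_transport S R (\<lambda>x. E' (E x)) (\<lambda>v. D (D' v)) (\<lambda>e. concat (map L (L' e))) \<eta>" ..
  then show ?thesis by (rule raw_leI)
qed

lemma iterated_limit_continuous_map:
  assumes "continuous_map T U D"
  shows "iterated_limit T k g l \<Longrightarrow> iterated_limit U k (\<lambda>ns. D (g ns)) (D l)"
proof (induction k arbitrary: g l)
  case (Suc k)
  then obtain h where h: "\<And>n. iterated_limit T k (\<lambda>ns. g (n # ns)) (h n)"
      "limitin T h l sequentially"
    by auto
  have "limitin U (D \<circ> h) (D l) sequentially"
    using continuous_map_limit[OF assms h(2)] .
  with Suc.IH[OF h(1)] show ?case
    by (auto intro!: exI[of _ "D \<circ> h"])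
qed simp

text \<open>
  The additional evaluation \<open>i\<close> keeps the query set nonempty: all query lists involved may be empty.
\<close>

lemma general_algorithm_transport:
  assumes i: "i \<in> idx S" and tr: "raw_transport S P E D L \<theta>" and ga: "general_algorithm P \<Gamma> Q"
  shows "general_algorithm S (\<lambda>x. D (\<Gamma> (E x))) (\<lambda>x. insert i (\<Union>e\<in>Q (E x). set (L e)))"
proof -
  note tr = raw_transportD[OF tr]
  let ?Q = "\<lambda>x. insert i (\<Union>e\<in>Q (E x). set (L e))"
  have Q: "finite (Q y)" "Q y \<subseteq> idx P" if "y \<in> inst P" for y
    using ga that unfolding general_algorithm_def by blast+
  have same: "\<Gamma> (E y) = \<Gamma> (E x) \<and> Q (E y) = Q (E x)"
    if x: "x \<in> inst S" and y: "y \<in> inst S" and agree: "\<forall>j\<in>?Q x. eval_at S j y = eval_at S j x"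
    for x y
  proof -
    have "eval_at P e (E y) = eval_at P e (E x)" if e: "e \<in> Q (E x)" for e
    proof -
      have "transcript S (L e) y = transcript S (L e) x"
        using e agree by (auto simp: transcript_def)
      moreover have "e \<in> idx P"
        using Q(2)[OF tr(1)[OF x]] e by blast
      ultimately show ?thesis using tr(6)[OF x] tr(6)[OF y] by simp
    qed
    then show ?thesis
      using ga tr(1)[OF x] tr(1)[OF y] unfolding general_algorithm_def by blast
  qed
  show ?thesis
    unfolding general_algorithm_def
  proof (intro conjI ballI funcsetI impI)
    fix x assume x: "x \<in> inst S"
    have "\<Gamma> (E x) \<in> mspace (met P)"
      using ga tr(1)[OF x] unfolding general_algorithm_def by blast
    then show "D (\<Gamma> (E x)) \<in> mspace (met S)"
      using continuous_map_image_subset_topspace[OF tr(2)] by auto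
    show "finite (?Q x)" using Q(1)[OF tr(1)[OF x]] by simp
    show "?Q x \<noteq> {}" by simp
    show "?Q x \<subseteq> idx S" using i Q(2)[OF tr(1)[OF x]] tr(3) by blast
    fix y assume y: "y \<in> inst S" and agree: "\<forall>j\<in>?Q x. eval_at S j y = eval_at S j x"
    show "D (\<Gamma> (E y)) = D (\<Gamma> (E x))" using same[OF x y agree] by simp
    show "?Q y = ?Q x" using same[OF x y agree] by simp
  qed
qed

lemma raw_tower_transport:
  assumes "sci_problem S" and tr: "raw_transport S P E D L \<theta>" and tower: "raw_tower P k \<Gamma> Q"
  shows "\<exists>\<Gamma>' Q'. raw_tower S k \<Gamma>' Q'"
proof -
  obtain i where i: "i \<in> idx S"
    using assms(1) unfolding sci_problem_def by blast
  let ?\<Gamma> = "\<lambda>ns x. D (\<Gamma> ns (E x))"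
  let ?Q = "\<lambda>ns x. insert i (\<Union>e\<in>Q ns (E x). set (L e))"
  have "raw_tower S k ?\<Gamma> ?Q"
    unfolding raw_tower_def
  proof (intro conjI allI impI ballI)
    fix ns :: "nat list" assume "length ns = k"
    then have "general_algorithm P (\<Gamma> ns) (Q ns)"
      using tower unfolding raw_tower_def by blast
    then show "general_algorithm S (?\<Gamma> ns) (?Q ns)"
      by (rule general_algorithm_transport[OF i tr])
  next
    fix x assume x: "x \<in> inst S"
    obtain l where l: "l \<in> target P (E x)"
        "iterated_limit (mtopology_of (met P)) k (\<lambda>ns. \<Gamma> ns (E x)) l"
      using tower raw_transportD(1)[OF tr x] unfolding raw_tower_def by blast
    have "D l \<in> target S x"
      using raw_transportD(5)[OF tr x] l(1) by blast
    with iterated_limit_continuous_map[OF raw_transportD(2)[OF tr] l(2)]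
    show "\<exists>l\<in>target S x. iterated_limit (mtopology_of (met S)) k (\<lambda>ns. ?\<Gamma> ns x) l" by blast
  qed
  then show ?thesis by blast
qed

lemma SCI_G_mono:
  assumes "sci_problem S" "raw_le S P" shows "SCI_G S \<le> SCI_G P"
proof -
  obtain E D L \<theta> where "raw_transport S P E D L \<theta>"
    using assms(2) unfolding raw_le_def by blast
  from raw_tower_transport[OF assms(1) this]
  show ?thesis
    unfolding SCI_G_def by (intro Inf_superset_mono) blast
qed

section \<open>Effective transports\<close>

lemma computable_map_id: "computable_map \<delta> \<delta> (\<lambda>x. x)"
proof -
  have "computable_functional Some"
    using computable_functional_recursive[OF recursive_query[OF recursive_id]] by simp
  then show ?thesis unfolding computable_map_def by blast
qed

lemma computable_map_comp:
  assumes "computable_map \<delta> \<epsilon> f" "computable_map \<epsilon> \<zeta> g"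
  shows "computable_map \<delta> \<zeta> (\<lambda>x. g (f x))"
proof -
  obtain K where K: "computable_functional K"
    "\<And>p x. \<delta> p = Some x \<Longrightarrow> \<exists>q. K p = Some q \<and> \<epsilon> q = Some (f x)"
    using assms(1) unfolding computable_map_def by blast
  obtain H where H: "computable_functional H"
    "\<And>p x. \<epsilon> p = Some x \<Longrightarrow> \<exists>q. H p = Some q \<and> \<zeta> q = Some (g x)"
    using assms(2) unfolding computable_map_def by blast
  have "\<exists>q. Option.bind (K p) H = Some q \<and> \<zeta> q = Some (g (f x))" if "\<delta> p = Some x" for p x
    using K(2)[OF that] H(2) by fastforce
  then show ?thesis
    using computable_functional_bind[OF K(1) H(1)] unfolding computable_map_def by blast
qed

text \<open>
  The single query \<open>[e]\<close> is reconstructed by reading column 0, with the same program for every \<open>e\<close>.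
\<close>

lemma tte_le_refl:
  assumes "represented_sci S" shows "tte_le S S"
proof -
  let ?c = "CompP QueryP (PairP ZeroP (PairP FstP SndP))"
  have "recursive (\<lambda>p e. pr (list_encode [e]) (index_of ?c))"
    unfolding list_encode.simps by (intro recursive_intros)
  then obtain r where r: "\<And>p e. run p r e = Some (pr (list_encode [e]) (index_of ?c))"
    unfolding recursive_def by blast
  have "realizes_partial ?c (list_rep (map (val_rep S) [e])) (val_rep S e) (\<lambda>vs. Some (hd vs))" for e
    unfolding realizes_partial_def
  proof (intro allI impI)
    fix p vs v
    assume "list_rep (map (val_rep S) [e]) p = Some vs \<and> Some (hd vs) = Some v"
    then have vs: "length vs = 1" "val_rep S e (col p 0) = Some (vs ! 0)" "hd vs = v"
      by (simp_all add: list_rep_eq_Some)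
    then have "val_rep S e (col p 0) = Some v"
      by (cases vs) simp_all
    moreover have "functional ?c p = Some (col p 0)"
      by (simp add: functional_eq_Some col_def)
    ultimately show "\<exists>q. functional ?c p = Some q \<and> val_rep S e q = Some v"
      by blast
  qed
  moreover have "raw_transport S S (\<lambda>x. x) (\<lambda>v. v) (\<lambda>e. [e]) (\<lambda>e. hd)"
    using assms unfolding represented_sci_def by (blast intro: raw_transport_refl)
  ultimately show ?thesis
    unfolding tte_le_def
    using computable_map_id[of "inst_rep S"] computable_map_id[of "met_rep S"] r
    by (intro exI[of _ "\<lambda>x. x"] exI[of _ "\<lambda>v. v"] exI[of _ "\<lambda>e. [e]"] exI[of _ "\<lambda>e. hd"]
        exI[of _ r] exI[of _ "\<lambda>e. ?c"] exI[of _ "\<lambda>e vs. Some (hd vs)"] conjI)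
      (auto simp: transcript_def)
qed

lemma tte_le_trans:
  assumes P: "represented_sci P" and R: "represented_sci R"
    and "tte_le S P" "tte_le P R"
  shows "tte_le S R"
proof -
  obtain E D L \<theta> r c \<theta>h where raw: "raw_transport S P E D L \<theta>"
    and E: "computable_map (inst_rep S) (inst_rep P) E"
    and D: "computable_map (met_rep P) (met_rep S) D"
    and eff: "\<forall>e\<in>idx P.
      run (\<lambda>_. 0) r e = Some (pr (list_encode (L e)) (index_of (c e))) \<and>
      realizes_partial (c e) (list_rep (map (val_rep S) (L e))) (val_rep P e) (\<theta>h e) \<and>
      (\<forall>x\<in>inst S. \<theta>h e (transcript S (L e) x) = Some (eval_at P e (E x)))"
    using assms(3) unfolding tte_le_def by (elim exE conjE)
  have r: "run (\<lambda>_. 0) r e = Some (pr (list_encode (L e)) (index_of (c e)))"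
    and c: "realizes_partial (c e) (list_rep (map (val_rep S) (L e))) (val_rep P e) (\<theta>h e)"
    and \<theta>h: "x \<in> inst S \<Longrightarrow> \<theta>h e (transcript S (L e) x) = Some (eval_at P e (E x))"
    if "e \<in> idx P" for e x
    using bspec[OF eff that] by blast+
  obtain E' D' L' \<theta>' r' c' \<theta>h' where raw': "raw_transport P R E' D' L' \<theta>'"
    and E': "computable_map (inst_rep P) (inst_rep R) E'"
    and D': "computable_map (met_rep R) (met_rep P) D'"
    and eff': "\<forall>e\<in>idx R.
      run (\<lambda>_. 0) r' e = Some (pr (list_encode (L' e)) (index_of (c' e))) \<and>
      realizes_partial (c' e) (list_rep (map (val_rep P) (L' e))) (val_rep R e) (\<theta>h' e) \<and>
      (\<forall>x\<in>inst P. \<theta>h' e (transcript P (L' e) x) = Some (eval_at R e (E' x)))"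
    using assms(4) unfolding tte_le_def by (elim exE conjE)
  have r': "run (\<lambda>_. 0) r' e = Some (pr (list_encode (L' e)) (index_of (c' e)))"
    and c': "realizes_partial (c' e) (list_rep (map (val_rep P) (L' e))) (val_rep R e) (\<theta>h' e)"
    and \<theta>h': "x \<in> inst P \<Longrightarrow> \<theta>h' e (transcript P (L' e) x) = Some (eval_at R e (E' x))"
    if "e \<in> idx R" for e x
    using bspec[OF eff' that] by blast+
  let ?E = "\<lambda>x. E' (E x)" and ?L = "\<lambda>e. concat (map L (L' e))"
  let ?c = "\<lambda>e. subst (transcript_prog L c (L' e)) (c' e)"
  obtain \<eta> where raw'': "raw_transport S R ?E (\<lambda>v. D (D' v)) ?L \<eta>"
    using raw_transport_trans[OF raw raw'] by blast
  \<comment> \<open>The domain is cut down to the transcript image: names of other lists need not be mapped by the inner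
    programs to names of transcripts of \<open>P\<close>.\<close>
  define \<eta>h where
    "\<eta>h e vs = (if vs \<in> transcript S (?L e) ` inst S then Some (\<eta> e vs) else None)" for e vs
  note L' = raw_transportD(3)[OF raw'] and E_in = raw_transportD(1)[OF raw]
  have \<eta>: "\<eta> e (transcript S (?L e) x) = eval_at R e (?E x)" if "e \<in> idx R" "x \<in> inst S" for e x
    using raw_transportD(6)[OF raw'' that(2,1)] by simp
  have dec_P: "decidable (idx P)" and dec_R: "decidable (idx R)"
    using P R unfolding represented_sci_def sci_problem_def by blast+
  \<comment> \<open>The given programs halt on valid indices only; total extensions exist as the index sets are decidable.\<close>
  obtain f where f: "recursive (\<lambda>_. f)"
      "\<And>e. e \<in> idx P \<Longrightarrow> f e = pr (list_encode (L e)) (index_of (c e))"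
    using recursive_on_decidable[OF dec_P r] by blast
  obtain f' where f': "recursive (\<lambda>_. f')"
      "\<And>e. e \<in> idx R \<Longrightarrow> f' e = pr (list_encode (L' e)) (index_of (c' e))"
    using recursive_on_decidable[OF dec_R r'] by blast
  obtain g where g: "recursive (\<lambda>_. g)"
      "\<And>is. set is \<subseteq> idx P \<Longrightarrow> g (list_encode is) =
         pr (list_encode (concat (map L is))) (index_of (transcript_prog L c is))"
    using recursive_transcript_prog[OF f] by blast
  have "recursive (\<lambda>p e. pr (pfst (g (pfst (f' e)))) (subst_code (psnd (g (pfst (f' e)))) (psnd (f' e))))"
    by (intro recursive_intros recursive_subst_code recursive_comp[OF g(1)] recursive_comp[OF f'(1)])
  then obtain s where s: "\<And>p e. run p s e
      = Some (pr (pfst (g (pfst (f' e)))) (subst_code (psnd (g (pfst (f' e)))) (psnd (f' e))))"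
    unfolding recursive_def by blast
  have "run (\<lambda>_. 0) s e = Some (pr (list_encode (?L e)) (index_of (?c e)))" if "e \<in> idx R" for e
    by (simp add: s f'(2)[OF that] g(2)[OF L'[OF that]] subst_code_index_of)
  moreover have "realizes_partial (?c e) (list_rep (map (val_rep S) (?L e))) (val_rep R e) (\<eta>h e)"
    if e: "e \<in> idx R" for e
    unfolding realizes_partial_def
  proof (intro allI impI)
    fix p vs v
    assume *: "list_rep (map (val_rep S) (?L e)) p = Some vs \<and> \<eta>h e vs = Some v"
    then obtain x where x: "x \<in> inst S" "vs = transcript S (?L e) x"
      by (auto simp: \<eta>h_def split: if_splits)
    have v: "v = eval_at R e (?E x)"
      using * x \<eta>[OF e x(1)] by (simp add: \<eta>h_def)
    obtain q where q: "functional (transcript_prog L c (L' e)) p = Some q"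
        "list_rep (map (val_rep P) (L' e)) q = Some (transcript P (L' e) (E x))"
      using list_rep_transcript_prog[OF c \<theta>h[OF _ x(1)] L'[OF e]] * x(2) by blast
    obtain q' where "functional (c' e) q = Some q'" "val_rep R e q' = Some (eval_at R e (?E x))"
      using c'[OF e] q(2) \<theta>h'[OF e E_in[OF x(1)]] unfolding realizes_partial_def by blast
    then show "\<exists>q. functional (?c e) p = Some q \<and> val_rep R e q = Some v"
      using functional_subst[OF q(1)] v by simp
  qed
  moreover have "\<eta>h e (transcript S (?L e) x) = Some (eval_at R e (?E x))"
    if "e \<in> idx R" "x \<in> inst S" for e x
    using \<eta>[OF that] that(2) by (simp add: \<eta>h_def)
  ultimately have "\<exists>r c \<theta>h. \<forall>e\<in>idx R.
      run (\<lambda>_. 0) r e = Some (pr (list_encode (?L e)) (index_of (c e))) \<and>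
      realizes_partial (c e) (list_rep (map (val_rep S) (?L e))) (val_rep R e) (\<theta>h e) \<and>
      (\<forall>x\<in>inst S. \<theta>h e (transcript S (?L e) x) = Some (eval_at R e (?E x)))"
    by (intro exI[of _ s] exI[of _ ?c] exI[of _ \<eta>h]) blast
  with raw'' computable_map_comp[OF E E'] computable_map_comp[OF D' D] show ?thesis
    unfolding tte_le_def by blast
qed

section \<open>From effective transports to Weihrauch reductions\<close>

lemma inst_rep_eq_Some:
  assumes "represented_sci P"
  shows "inst_rep P p = Some x \<longleftrightarrow> x \<in> inst P \<and> table_rep P p = Some (table P x)"
proof -
  have inj: "inj_on (table P) (inst P)"
    using assms unfolding represented_sci_def by blast
  have "t \<in> table P ` inst P" if "table_rep P p = Some t" for t
    using that by (auto simp: table_rep_def subspace_rep_def bind_eq_Some_conv split: if_splits)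
  then show ?thesis
    using inj by (auto simp: inst_rep_def inv_into_f_f)
qed

lemma table_rep_imp_inst_rep:
  assumes "represented_sci P" "table_rep P p = Some t"
  obtains x where "x \<in> inst P" "t = table P x" "inst_rep P p = Some x"
proof -
  have "t \<in> table P ` inst P"
    using assms(2) by (auto simp: table_rep_def subspace_rep_def bind_eq_Some_conv split: if_splits)
  with inst_rep_eq_Some[OF assms(1)] assms(2) that show thesis by blast
qed

lemma sol_factor_table:
  assumes "represented_sci P" "x \<in> inst P" shows "sol (factor P) (table P x) = target P x"
proof -
  have "inj_on (table P) (inst P)"
    using assms(1) unfolding represented_sci_def by blast
  then have "{y \<in> inst P. table P y = table P x} = {x}"
    using assms(2) by (auto dest: inj_onD)
  then show ?thesis by (simp add: factor_def)
qed

text \<open>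
  The common core of the reductions: \<open>K\<close> maps names of inputs of \<open>factor S\<close> to names of inputs of
  \<open>factor P\<close>, and \<open>H\<close> turns names of solutions of the latter into names of solutions of the former
  without access to the original input, which is what makes the reduction strong.
\<close>

lemma tte_le_realizers:
  assumes S: "represented_sci S" and P: "represented_sci P" and "tte_le S P"
  obtains K H where "computable_functional K" "computable_functional H"
    "\<And>p t. table_rep S p = Some t \<Longrightarrow> \<exists>q u. K p = Some q \<and> table_rep P q = Some u \<and>
       sol (factor P) u \<noteq> {} \<and>
       (\<forall>q' v. met_rep P q' = Some v \<longrightarrow> v \<in> sol (factor P) u \<longrightarrow>
          (\<exists>s w. H q' = Some s \<and> met_rep S s = Some w \<and> w \<in> sol (factor S) t))"
proof -
  obtain E D L \<theta> where tr: "raw_transport S P E D L \<theta>"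
    and E: "computable_map (inst_rep S) (inst_rep P) E"
    and D: "computable_map (met_rep P) (met_rep S) D"
    using assms(3) unfolding tte_le_def by blast
  obtain K where K: "computable_functional K"
    "\<And>p x. inst_rep S p = Some x \<Longrightarrow> \<exists>q. K p = Some q \<and> inst_rep P q = Some (E x)"
    using E unfolding computable_map_def by blast
  obtain H where H: "computable_functional H"
    "\<And>p v. met_rep P p = Some v \<Longrightarrow> \<exists>q. H p = Some q \<and> met_rep S q = Some (D v)"
    using D unfolding computable_map_def by blast
  show thesis
  proof (rule that[OF K(1) H(1)])
    fix p t assume "table_rep S p = Some t"
    then obtain x where x: "x \<in> inst S" "t = table S x" "inst_rep S p = Some x"
      by (rule table_rep_imp_inst_rep[OF S])
    obtain q where q: "K p = Some q" "inst_rep P q = Some (E x)"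
      using K(2)[OF x(3)] by blast
    have Ex: "E x \<in> inst P" "table_rep P q = Some (table P (E x))"
      using q(2) inst_rep_eq_Some[OF P] by blast+
    have "target P (E x) \<noteq> {}" "D ` target P (E x) \<subseteq> target S x"
      using raw_transportD(4,5)[OF tr x(1)] by blast+
    then show "\<exists>q u. K p = Some q \<and> table_rep P q = Some u \<and> sol (factor P) u \<noteq> {} \<and>
       (\<forall>q' v. met_rep P q' = Some v \<longrightarrow> v \<in> sol (factor P) u \<longrightarrow>
          (\<exists>s w. H q' = Some s \<and> met_rep S s = Some w \<and> w \<in> sol (factor S) t))"
      using q(1) Ex x(2) sol_factor_table[OF P Ex(1)] sol_factor_table[OF S x(1)] H(2)
      by (intro exI[of _ q] exI[of _ "table P (E x)"]) (auto; blast)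
  qed
qed

lemma tte_le_imp_sW_le:
  assumes "represented_sci S" "represented_sci P" "tte_le S P"
  shows "sW_le (factor S) (factor P)"
proof -
  obtain K H where KH: "computable_functional K" "computable_functional H"
    "\<And>p t. table_rep S p = Some t \<Longrightarrow> \<exists>q u. K p = Some q \<and> table_rep P q = Some u \<and>
       sol (factor P) u \<noteq> {} \<and>
       (\<forall>q' v. met_rep P q' = Some v \<longrightarrow> v \<in> sol (factor P) u \<longrightarrow>
          (\<exists>s w. H q' = Some s \<and> met_rep S s = Some w \<and> w \<in> sol (factor S) t))"
    using tte_le_realizers[OF assms] by blast
  have reps: "in_rep (factor P) = table_rep P" "out_rep (factor P) = met_rep P"
    "in_rep (factor S) = table_rep S" "out_rep (factor S) = met_rep S"
    by (simp_all add: factor_def)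
  have "realizer (factor S) (\<lambda>p. Option.bind (Option.bind (K p) G) H)"
    if G: "realizer (factor P) G" for G
    unfolding realizer_def reps
  proof (intro allI impI)
    fix p t assume "table_rep S p = Some t \<and> sol (factor S) t \<noteq> {}"
    then obtain q u where q: "K p = Some q" "table_rep P q = Some u" "sol (factor P) u \<noteq> {}"
      and H: "\<And>q' v. met_rep P q' = Some v \<Longrightarrow> v \<in> sol (factor P) u \<Longrightarrow>
          \<exists>s w. H q' = Some s \<and> met_rep S s = Some w \<and> w \<in> sol (factor S) t"
      using KH(3) by blast
    obtain q' v where "G q = Some q'" "met_rep P q' = Some v" "v \<in> sol (factor P) u"
      using G q(2,3) unfolding realizer_def reps by blast
    with q(1) H show "\<exists>s w. Option.bind (Option.bind (K p) G) H = Some s \<and>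
        met_rep S s = Some w \<and> w \<in> sol (factor S) t"
      by simp
  qed
  with KH(1,2) show ?thesis unfolding sW_le_def by blast
qed

text \<open>
  With \<open>M\<close> solving \<open>factor P\<close> through \<open>k\<close> limits, the final \<open>H\<close> of \<open>H \<circ> Lim^k \<circ> M \<circ> K\<close> is moved below
  the limits, which leaves \<open>Lim^k\<close> applied to a computable functional.
\<close>

lemma SCI_Comp_mono:
  assumes "represented_sci S" "represented_sci P" "tte_le S P"
  shows "SCI_Comp S \<le> SCI_Comp P"
proof -
  obtain K H where KH: "computable_functional K" "computable_functional H"
    "\<And>p t. table_rep S p = Some t \<Longrightarrow> \<exists>q u. K p = Some q \<and> table_rep P q = Some u \<and>
       sol (factor P) u \<noteq> {} \<and>
       (\<forall>q' v. met_rep P q' = Some v \<longrightarrow> v \<in> sol (factor P) u \<longrightarrow>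
          (\<exists>s w. H q' = Some s \<and> met_rep S s = Some w \<and> w \<in> sol (factor S) t))"
    using tte_le_realizers[OF assms] by blast
  have "\<exists>K'. computable_functional K' \<and> (\<forall>p t. table_rep S p = Some t \<longrightarrow>
      (\<exists>q v. Option.bind (K' p) (Lim_pow k) = Some q \<and> met_rep S q = Some v \<and> v \<in> sol (factor S) t))"
    if M: "computable_functional M" "\<forall>p t. table_rep P p = Some t \<longrightarrow>
      (\<exists>q v. Option.bind (M p) (Lim_pow k) = Some q \<and> met_rep P q = Some v \<and> v \<in> sol (factor P) t)"
    for k M
  proof -
    obtain J where J: "computable_functional J"
      "\<And>P q r. Lim_pow k P = Some q \<Longrightarrow> H q = Some r \<Longrightarrow> Option.bind (J P) (Lim_pow k) = Some r"
      using Lim_pow_absorbs_computable[OF KH(2)] by blast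
    let ?K = "\<lambda>p. Option.bind (Option.bind (K p) M) J"
    have "\<exists>s w. Option.bind (?K p) (Lim_pow k) = Some s \<and> met_rep S s = Some w \<and> w \<in> sol (factor S) t"
      if t: "table_rep S p = Some t" for p t
    proof -
      obtain q u where q: "K p = Some q" "table_rep P q = Some u"
        and H: "\<And>q' v. met_rep P q' = Some v \<Longrightarrow> v \<in> sol (factor P) u \<Longrightarrow>
            \<exists>s w. H q' = Some s \<and> met_rep S s = Some w \<and> w \<in> sol (factor S) t"
        using KH(3)[OF t] by blast
      obtain q' v where "Option.bind (M q) (Lim_pow k) = Some q'"
        and v: "met_rep P q' = Some v" "v \<in> sol (factor P) u"
        using M(2) q(2) by blast
      then obtain m where m: "M q = Some m" "Lim_pow k m = Some q'"
        by (auto simp: bind_eq_Some_conv)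
      obtain s w where s: "H q' = Some s" "met_rep S s = Some w" "w \<in> sol (factor S) t"
        using H[OF v] by blast
      show ?thesis
        using J(2)[OF m(2) s(1)] s(2,3) q(1) m(1) by simp
    qed
    then show ?thesis
      using computable_functional_bind[OF computable_functional_bind[OF KH(1) M(1)] J(1)] by blast
  qed
  then show ?thesis
    unfolding SCI_Comp_def by (intro Inf_superset_mono) blast
qed

theorem theorem4p3:
  shows
    "(\<forall>S :: ('x1, 'v1, 'm1) sci. sci_problem S \<longrightarrow> raw_le S S) \<and>
     (\<forall>(S :: ('x1, 'v1, 'm1) sci) (P :: ('x2, 'v2, 'm2) sci) (R :: ('x3, 'v3, 'm3) sci).
        sci_problem S \<longrightarrow> sci_problem P \<longrightarrow> sci_problem R \<longrightarrow>
        raw_le S P \<longrightarrow> raw_le P R \<longrightarrow> raw_le S R) \<and>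
     (\<forall>S :: ('x1, 'v1, 'm1) rsci. represented_sci S \<longrightarrow> tte_le S S) \<and>
     (\<forall>(S :: ('x1, 'v1, 'm1) rsci) (P :: ('x2, 'v2, 'm2) rsci) (R :: ('x3, 'v3, 'm3) rsci).
        represented_sci S \<longrightarrow> represented_sci P \<longrightarrow> represented_sci R \<longrightarrow>
        tte_le S P \<longrightarrow> tte_le P R \<longrightarrow> tte_le S R) \<and>
     (\<forall>(S :: ('x1, 'v1, 'm1) sci) (P :: ('x2, 'v2, 'm2) sci).
        sci_problem S \<longrightarrow> sci_problem P \<longrightarrow> raw_le S P \<longrightarrow> SCI_G S \<le> SCI_G P) \<and>
     (\<forall>(S :: ('x1, 'v1, 'm1) rsci) (P :: ('x2, 'v2, 'm2) rsci).
        represented_sci S \<longrightarrow> represented_sci P \<longrightarrow>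
          (tte_le S P \<longrightarrow> sW_le (factor S) (factor P)) \<and>
          (sW_le (factor S) (factor P) \<longrightarrow> W_le (factor S) (factor P)) \<and>
          (tte_le S P \<longrightarrow> rk_lim (factor S) \<le> rk_lim (factor P)) \<and>
          (tte_le S P \<longrightarrow> SCI_Comp S \<le> SCI_Comp P))"
proof (intro conjI allI impI, goal_cases)
  case 1 then show ?case by (rule raw_le_refl)
next
  case 2 then show ?case by (blast intro: raw_le_trans)
next
  case 3 then show ?case by (rule tte_le_refl)
next
  case (4 S P R) then show ?case using tte_le_trans[of P R S] by blast
next
  case 5 then show ?case using SCI_G_mono by blast
next
  case 6 then show ?case by (rule tte_le_imp_sW_le)
next
  case 7 then show ?case using sW_le_imp_W_le by blast
next
  case 8 then show ?case using rk_lim_mono[OF tte_le_imp_sW_le] by blast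
next
  case 9 then show ?case by (rule SCI_Comp_mono)
qed

end
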